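(* Assume the auxiliary variables are discrete ($\mathcal A\subseteq\mathbb R^{d_a}$ discrete). Let $\theta=(f,p,G)$ and $\hat\theta=(\hat f,\hat p,\hat G)$ be two graphical latent models such that for every $t\in[T]$, $i\in[d_z]$ and every fixed $a^{<t}\in\mathcal A^t$ the factors $p(z_i^t\mid z^{<t},a^{<t})$ and $\hat p(z_i^t\mid z^{<t},a^{<t})$ are $C^2$ functions of $(z_i^t,z^{<t})\in\mathbb R\times\mathbb R^{d_z\times(t-1)}$. Assume: 1. (Observational equivalence) $\theta\sim_{\rm obs}\hat\theta$. 2. (Sufficient influence of $a$) For Lebesgue-almost every $z\in\mathbb R^{d_z}$ and every $\ell\in[d_a]$ there exist tuples $(t_{(r)},\tau_{(r)},z_{(r)},a_{(r)},\epsilon_{(r)})$, $r=1,\dots,|\mathrm{Ch}^a_\ell|$, with $t_{(r)}\in[T]$, $0\le\tau_{(r)}<t_{(r)}$, $z_{(r)}\in\mathbb R^{d_z\times(t_{(r)}-1)}$, $a_{(r)}\in\mathcal A^{t_{(r)}}$, $\epsilon_{(r)}\in\mathbb R$, $(a_{(r)})_{\cdot,\tau_{(r)}}+\epsilon_{(r)}e_\ell\in\mathcal A$, such that $$\mathrm{span}\Big\{\Delta^{\tau_{(r)},\epsilon_{(r)}}_{a,\ell}D^{t_{(r)}}_z\log p(z\mid z_{(r)},a_{(r)})\Big\}_{r=1}^{|\mathrm{Ch}^a_\ell|}=\mathbb R^{d_z}_{\mathrm{Ch}^a_\ell}.$$ Then there exists a $d_z\times d_z$ permutation matrix $P$ such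 that $PG^a\subseteq\hat G^a$. If in addition 3. (Sparsity) $\|\hat G^a\|_0\le\|G^a\|_0$, then $\theta\sim^{a}_{\rm con}\hat\theta$ ($\theta$ and $\hat\theta$ are $a$-consistent).
   Context: **Notation.** $[n]=\{1,\dots,n\}$; $e_\ell$ is the $\ell$-th standard basis vector. Fix positive integers $T,d_x,d_z,d_a$ with $d_z\le d_x$, a constant $\sigma^2\ge0$ and a nonempty set $\mathcal A\subseteq\mathbb R^{d_a}$. Write $z^{<t}=(z^1,\dots,z^{t-1})\in\mathbb R^{d_z\times(t-1)}$ and $a^{<t}=(a^0,\dots,a^{t-1})\in\mathcal A^t$ (columns indexed by time). For binary matrices, $A\subseteq B$ means every nonzero position of $A$ is a nonzero position of $B$; $\|A\|_0$ is the number of nonzero entries. For $S\subseteq[m]$, $\mathbb R^m_S=\{x\in\mathbb R^m: x_i=0\ \forall i\notin S\}$. For $B\in\{0,1\}^{m\times n}$, $\mathbb R^{m\times n}_B=\{M\in\mathbb R^{m\times n}:B_{i,j}=0\Rightarrow M_{i,j}=0\}$. A map defined on an arbitrary subset of $\mathbb R^n$ is $C^k$ if it extends to a $C^k$ map on an open set containing that subset. A diffeomorphism is a $C^1$ bijection with $C^1$ inverse. A permutation matrix is identified with the linear map it defines. **Graphical latent model.** A triple $\theta=(f,p,G)$, $G=[G^z,G^a]$, $G^z\in\{0,1\}^{d_z\times d_z}$, $G^a\in\{0,1\}^{d_z\times d_a}$, such that: (i) $f:\mathbb R^{d_z}\to\mathbb R^{d_x}$ is a diffeomorphism onto its image, and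 $f(\mathbb R^{d_z})$ is closed in $\mathbb R^{d_x}$; observations are $x^t=f(z^t)+n^t$, $t\in[T]$, where the $n^t\sim\mathcal N(0,\sigma^2I)$ are independent across time and independent of all $z$'s and $a$'s; (ii) for each $t\in[T]$, the latent vector $z^t$ has, given $z^{<t}$ and $a^{<t}$, a conditional density with respect to Lebesgue measure $p(z^t\mid z^{<t},a^{<t})=\prod_{i=1}^{d_z}p(z^t_i\mid z^{<t},a^{<t})$, each factor being strictly positive on $\mathbb R$ (for $t=1$ the conditioning is on $a^0$ only); (iii) for each $i$ and $t$, $p(z^t_i\mid z^{<t},a^{<t})$ depends on $(z^{<t},a^{<t})$ only through the rows $z_j^{<t}$ with $G^z_{i,j}=1$ and the rows $a_\ell^{<t}$ with $G^a_{i,\ell}=1$. $\mathrm{Ch}^a_\ell=\{i\in[d_z]:G^a_{i,\ell}=1\}$. **Partial difference.** $D^t_z\log p(z^t\mid z^{<t},a^{<t})\in\mathbb R^{d_z}$ is the vector of partial derivatives with respect to $z^t$, and $\Delta^{\tau,\epsilon}_{a,\ell}D^t_z\log p(z^t\mid z^{<t},a^{<t}):=D^t_z\log p(z^t\mid z^{<t},a^{<t}+\epsilon E^{(\ell,\tau)})-D^t_z\log p(z^t\mid z^{<t},a^{<t})$, where $E^{(\ell,\tau)}\in\mathbb R^{d_a\times t}$ has a one at row $\ell$ and the column of time $\tau$, and zeros elsewhere. **Observational equivalence.** $\theta\sim_{\rm obs}\tilde\theta$ iff for every $a^{<T}\in\mathcal A^T$ the conditional distributions of $(x^1,\dots,x^T)$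 given $a^{<T}$ induced by $\theta$ and $\tilde\theta$ (same $\sigma^2$) coincide. **Equivalence up to diffeomorphism.** $\theta\sim_{\rm diff}\tilde\theta$ iff $f(\mathbb R^{d_z})=\tilde f(\mathbb R^{d_z})$ and, with $v:=f^{-1}\circ\tilde f$ (the entanglement map, a diffeomorphism of $\mathbb R^{d_z}$), for all $t\in[T]$, $a^{<t}\in\mathcal A^t$, $z^{\le t}\in\mathbb R^{d_z\times t}$: $\tilde p(z^t\mid z^{<t},a^{<t})=p(v(z^t)\mid v(z^{<t}),a^{<t})\,|\det Dv(z^t)|$, where $v$ is applied columnwise to $z^{<t}$. **Dependency graph and $G$-preservation.** The dependency graph of $h:\mathbb R^n\to\mathbb R^m$ is $H\in\{0,1\}^{m\times n}$ with $H_{i,j}=0$ iff $h_i$ does not depend on its $j$-th argument (i.e. $h_i(a)=\bar h_i(a_{-j})$ for all $a$ for some function $\bar h_i$ of the remaining coordinates). For $B\in\{0,1\}^{m\times n}$, a matrix $C\in\mathbb R^{m\times m}$ is $B$-preserving if $C^\top\mathbb R^{m\times n}_B\subseteq\mathbb R^{m\times n}_B$; a function $c:\mathbb R^m\to\mathbb R^m$ is $B$-preserving if its dependency graph is a $B$-preserving matrix. **$a$-consistency.** $\theta\sim^a_{\rm con}\tilde\theta$ iff there is a permutation matrix $P$ such that $\theta\sim_{\rm diff}\tilde\theta$, $\tilde G^a=PG^a$, and $v=f^{-1}\circ\tilde f$ can be written $v=c\circ P^\top$ with $c$ a $G^a$-preserving diffeomorphism. *)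

theory Defs
  imports "HOL-Probability.Probability"
begin

subsection \<open>Binary matrices and permutation matrices\<close>

definition binary_matrix :: "real^'n^'m \<Rightarrow> bool" where
  "binary_matrix B \<longleftrightarrow> (\<forall>i j. B $ i $ j \<in> {0, 1})"

definition pattern_subset :: "real^'n^'m \<Rightarrow> real^'n^'m \<Rightarrow> bool" where
  "pattern_subset A B \<longleftrightarrow> (\<forall>i j. A $ i $ j \<noteq> 0 \<longrightarrow> B $ i $ j \<noteq> 0)"

definition l0_norm :: "real^'n^'m \<Rightarrow> nat" where
  "l0_norm B = card {(i, j). B $ i $ j \<noteq> 0}"

definition permutation_matrix :: "real^'n^'n \<Rightarrow> bool" where
  "permutation_matrix P \<longleftrightarrow> (\<exists>\<pi>. bij \<pi> \<and> P = (\<chi> i j. if i = \<pi> j then 1 else 0))"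

definition coord_subspace :: "'m set \<Rightarrow> (real^'m) set" where
  "coord_subspace S = {x. \<forall>i. i \<notin> S \<longrightarrow> x $ i = 0}"

definition matrix_subspace :: "real^'n^'m \<Rightarrow> (real^'n^'m) set" where
  "matrix_subspace B = {M. \<forall>i j. B $ i $ j = 0 \<longrightarrow> M $ i $ j = 0}"

subsection \<open>Dependency graphs and preservation\<close>

text \<open>\<open>restrict (($) x) (- {j})\<close> is the tuple of all coordinates of \<open>x\<close> except the one at \<open>j\<close>.\<close>

definition dependency_graph :: "(real^'n \<Rightarrow> real^'m) \<Rightarrow> real^'n^'m" where
  "dependency_graph h =
     (\<chi> i j. if \<exists>hbar. \<forall>x. h x $ i = hbar (restrict (($) x) (- {j})) then 0 else 1)"

definition preserving_matrix :: "real^'n^'m \<Rightarrow> real^'m^'m \<Rightarrow> bool" where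
  "preserving_matrix B C \<longleftrightarrow> (\<lambda>M. transpose C ** M) ` matrix_subspace B \<subseteq> matrix_subspace B"

definition preserving_function :: "real^'n^'m \<Rightarrow> (real^'m \<Rightarrow> real^'m) \<Rightarrow> bool" where
  "preserving_function B c \<longleftrightarrow> preserving_matrix B (dependency_graph c)"

subsection \<open>Differentiability classes\<close>

definition C1_on :: "'a::euclidean_space set \<Rightarrow> ('a \<Rightarrow> 'b::euclidean_space) \<Rightarrow> bool" where
  "C1_on S f \<longleftrightarrow>
     (\<exists>U g. open U \<and> S \<subseteq> U \<and> (\<forall>x\<in>S. g x = f x) \<and>
        (\<exists>g'. (\<forall>x\<in>U. (g has_derivative blinfun_apply (g' x)) (at x)) \<and> continuous_on U g'))"

definition diffeomorphism_on ::
    "'a::euclidean_space set \<Rightarrow> 'b::euclidean_space set \<Rightarrow> ('a \<Rightarrow> 'b) \<Rightarrow> bool" where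
  "diffeomorphism_on S S' f \<longleftrightarrow> bij_betw f S S' \<and> C1_on S f \<and> C1_on S' (inv_into S f)"

text \<open>
  The number of columns of a latent history varies with time, so functions of a history are
  treated as functions on the space of real families over a finite index set \<open>I\<close>, represented
  as the extensional functions \<open>I \<rightarrow>\<^sub>E UNIV\<close> with the product topology.
  \<open>Ck_coord k I g\<close> says that all iterated partial derivatives of \<open>g\<close> up to order \<open>k\<close>
  exist and are continuous on this space.
\<close>

fun Ck_coord :: "nat \<Rightarrow> 'i set \<Rightarrow> (('i \<Rightarrow> real) \<Rightarrow> real) \<Rightarrow> bool" where
  "Ck_coord 0 I g \<longleftrightarrow> continuous_on (I \<rightarrow>\<^sub>E UNIV) g"
| "Ck_coord (Suc k) I g \<longleftrightarrow>
     continuous_on (I \<rightarrow>\<^sub>E UNIV) g \<and>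
     (\<forall>i\<in>I. \<exists>g'. (\<forall>x\<in>I \<rightarrow>\<^sub>E UNIV. ((\<lambda>u. g (x(i := u))) has_real_derivative g' x) (at (x i)))
        \<and> Ck_coord k I g')"

subsection \<open>Graphical latent models\<close>

text \<open>
  The index types \<open>'x\<close>, \<open>'z\<close>, \<open>'a\<close> have cardinalities \<open>d\<^sub>x\<close>, \<open>d\<^sub>z\<close>, \<open>d\<^sub>a\<close>.
  The value \<open>factor \<theta> t i s zh ah\<close> is the conditional density of \<open>z\<^sup>t\<^sub>i\<close> at \<open>s\<close> given
  \<open>z\<^sup><\<^sup>t = zh\<close> and \<open>a\<^sup><\<^sup>t = ah\<close>.  Histories are extensional functions of time: latent histories
  live on \<open>{1..<t}\<close>, histories of the auxiliary variable on \<open>{0..<t}\<close>.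
  Values of \<open>factor\<close> outside these ranges are never used.
\<close>

record ('x::finite, 'z::finite, 'a::finite) latent_model =
  mixing :: "real^'z \<Rightarrow> real^'x"
  factor :: "nat \<Rightarrow> 'z \<Rightarrow> real \<Rightarrow> (nat \<Rightarrow> real^'z) \<Rightarrow> (nat \<Rightarrow> real^'a) \<Rightarrow> real"
  graph_z :: "real^'z^'z"
  graph_a :: "real^'a^'z"

abbreviation z_hists :: "nat \<Rightarrow> (nat \<Rightarrow> real^'z) set" where
  "z_hists t \<equiv> {1..<t} \<rightarrow>\<^sub>E UNIV"

abbreviation a_hists :: "(real^'a) set \<Rightarrow> nat \<Rightarrow> (nat \<Rightarrow> real^'a) set" where
  "a_hists \<A> t \<equiv> {0..<t} \<rightarrow>\<^sub>E \<A>"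

text \<open>The transition density \<open>p(z\<^sup>t | z\<^sup><\<^sup>t, a\<^sup><\<^sup>t)\<close>.\<close>

definition trans_density ::
    "('x::finite, 'z::finite, 'a::finite) latent_model \<Rightarrow> nat \<Rightarrow> real^'z \<Rightarrow>
     (nat \<Rightarrow> real^'z) \<Rightarrow> (nat \<Rightarrow> real^'a) \<Rightarrow> real" where
  "trans_density \<theta> t z zh ah = (\<Prod>i\<in>UNIV. factor \<theta> t i (z $ i) zh ah)"

definition graphical_latent_model ::
    "nat \<Rightarrow> (real^'a) set \<Rightarrow> ('x::finite, 'z::finite, 'a::finite) latent_model \<Rightarrow> bool" where
  "graphical_latent_model T \<A> \<theta> \<longleftrightarrow>
     binary_matrix (graph_z \<theta>) \<and> binary_matrix (graph_a \<theta>) \<and>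
     diffeomorphism_on UNIV (range (mixing \<theta>)) (mixing \<theta>) \<and> closed (range (mixing \<theta>)) \<and>
     (\<forall>t\<in>{1..T}. \<forall>i. \<forall>ah\<in>a_hists \<A> t.
        (\<lambda>(s, zh). factor \<theta> t i s zh ah) \<in> borel_measurable (borel \<Otimes>\<^sub>M (\<Pi>\<^sub>M s\<in>{1..<t}. borel)) \<and>
        (\<forall>zh\<in>z_hists t.
           (\<forall>s. 0 < factor \<theta> t i s zh ah) \<and>
           (\<integral>\<^sup>+ s. ennreal (factor \<theta> t i s zh ah) \<partial>lborel) = 1)) \<and>
     (\<forall>t\<in>{1..T}. \<forall>i. \<forall>zh\<in>z_hists t. \<forall>zh'\<in>z_hists t. \<forall>ah\<in>a_hists \<A> t. \<forall>ah'\<in>a_hists \<A> t.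
        (\<forall>j. graph_z \<theta> $ i $ j = 1 \<longrightarrow> (\<forall>s\<in>{1..<t}. zh s $ j = zh' s $ j)) \<longrightarrow>
        (\<forall>l. graph_a \<theta> $ i $ l = 1 \<longrightarrow> (\<forall>s\<in>{0..<t}. ah s $ l = ah' s $ l)) \<longrightarrow>
        (\<forall>s. factor \<theta> t i s zh ah = factor \<theta> t i s zh' ah'))"

definition children_a ::
    "('x::finite, 'z::finite, 'a::finite) latent_model \<Rightarrow> 'a \<Rightarrow> 'z set" where
  "children_a \<theta> l = {i. graph_a \<theta> $ i $ l = 1}"

text \<open>
  \<open>(s, zh)\<close> with \<open>s\<close> real and \<open>zh\<close> in \<open>z_hists t\<close> is flattened to one real family: \<open>None\<close> indexes
  \<open>s\<close> and \<open>Some (r, j)\<close> indexes the \<open>j\<close>-th coordinate of \<open>zh r\<close>.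
\<close>

definition C2_factors ::
    "nat \<Rightarrow> (real^'a) set \<Rightarrow> ('x::finite, 'z::finite, 'a::finite) latent_model \<Rightarrow> bool" where
  "C2_factors T \<A> \<theta> \<longleftrightarrow>
     (\<forall>t\<in>{1..T}. \<forall>i. \<forall>ah\<in>a_hists \<A> t.
        Ck_coord 2 (insert None (Some ` ({1..<t} \<times> UNIV)))
          (\<lambda>y. factor \<theta> t i (y None) (\<lambda>r\<in>{1..<t}. \<chi> j. y (Some (r, j))) ah))"

subsection \<open>Observational equivalence\<close>

text \<open>
  The law of \<open>(z\<^sup>1, \<dots>, z\<^sup>T)\<close> given \<open>a\<^sup><\<^sup>T\<close>, obtained by chaining the transition densities.
\<close>

definition latent_law ::
    "nat \<Rightarrow> ('x::finite, 'z::finite, 'a::finite) latent_model \<Rightarrow> (nat \<Rightarrow> real^'a) \<Rightarrow>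
     (nat \<Rightarrow> real^'z) measure" where
  "latent_law T \<theta> ah =
     density (\<Pi>\<^sub>M t\<in>{1..T}. lborel)
       (\<lambda>z. ennreal (\<Prod>t\<in>{1..T}. trans_density \<theta> t (z t) (restrict z {1..<t}) (restrict ah {0..<t})))"

text \<open>
  \<open>N(0, \<sigma>\<^sup>2 I)\<close> as the law of \<open>\<sigma>\<close> times a standard Gaussian vector, so that \<open>\<sigma>\<^sup>2 = 0\<close> gives the point
  mass at zero (\<open>normal_density\<close> is not a density for \<open>\<sigma> = 0\<close>).
\<close>

definition gaussian_noise :: "real \<Rightarrow> (real^'x) measure" where
  "gaussian_noise \<sigma>2 =
     distr (\<Pi>\<^sub>M i\<in>UNIV. density lborel (\<lambda>u. ennreal (std_normal_density u))) borel
       (\<lambda>w. sqrt \<sigma>2 *\<^sub>R (\<chi> i. w i))"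

definition obs_law ::
    "nat \<Rightarrow> real \<Rightarrow> ('x::finite, 'z::finite, 'a::finite) latent_model \<Rightarrow> (nat \<Rightarrow> real^'a) \<Rightarrow>
     (nat \<Rightarrow> real^'x) measure" where
  "obs_law T \<sigma>2 \<theta> ah =
     distr (latent_law T \<theta> ah \<Otimes>\<^sub>M (\<Pi>\<^sub>M t\<in>{1..T}. gaussian_noise \<sigma>2)) (\<Pi>\<^sub>M t\<in>{1..T}. borel)
       (\<lambda>(z, n). \<lambda>t\<in>{1..T}. mixing \<theta> (z t) + n t)"

definition obs_equivalent ::
    "nat \<Rightarrow> (real^'a) set \<Rightarrow> real \<Rightarrow> ('x::finite, 'z::finite, 'a::finite) latent_model \<Rightarrow>
     ('x, 'z, 'a) latent_model \<Rightarrow> bool" where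
  "obs_equivalent T \<A> \<sigma>2 \<theta> \<theta>' \<longleftrightarrow>
     (\<forall>ah\<in>a_hists \<A> T. obs_law T \<sigma>2 \<theta> ah = obs_law T \<sigma>2 \<theta>' ah)"

subsection \<open>Equivalence up to diffeomorphism and consistency\<close>

definition entanglement_map ::
    "('x::finite, 'z::finite, 'a::finite) latent_model \<Rightarrow> ('x, 'z, 'a) latent_model \<Rightarrow>
     real^'z \<Rightarrow> real^'z" where
  "entanglement_map \<theta> \<theta>' = inv (mixing \<theta>) \<circ> mixing \<theta>'"

definition diff_equivalent ::
    "nat \<Rightarrow> (real^'a) set \<Rightarrow> ('x::finite, 'z::finite, 'a::finite) latent_model \<Rightarrow>
     ('x, 'z, 'a) latent_model \<Rightarrow> bool" where
  "diff_equivalent T \<A> \<theta> \<theta>' \<longleftrightarrow>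
     range (mixing \<theta>) = range (mixing \<theta>') \<and>
     (let v = entanglement_map \<theta> \<theta>' in
      \<forall>t\<in>{1..T}. \<forall>ah\<in>a_hists \<A> t. \<forall>zh\<in>z_hists t. \<forall>z.
        trans_density \<theta>' t z zh ah =
          trans_density \<theta> t (v z) (\<lambda>s\<in>{1..<t}. v (zh s)) ah * \<bar>det (jacobian v (at z))\<bar>)"

definition a_consistent ::
    "nat \<Rightarrow> (real^'a) set \<Rightarrow> ('x::finite, 'z::finite, 'a::finite) latent_model \<Rightarrow>
     ('x, 'z, 'a) latent_model \<Rightarrow> bool" where
  "a_consistent T \<A> \<theta> \<theta>' \<longleftrightarrow>
     (\<exists>P. permutation_matrix P \<and> diff_equivalent T \<A> \<theta> \<theta>' \<and>
        graph_a \<theta>' = P ** graph_a \<theta> \<and>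
        (\<exists>c. entanglement_map \<theta> \<theta>' = c \<circ> (\<lambda>z. transpose P *v z) \<and>
           diffeomorphism_on UNIV UNIV c \<and> preserving_function (graph_a \<theta>) c))"

subsection \<open>Partial differences of the score\<close>

definition score ::
    "('x::finite, 'z::finite, 'a::finite) latent_model \<Rightarrow> nat \<Rightarrow> real^'z \<Rightarrow>
     (nat \<Rightarrow> real^'z) \<Rightarrow> (nat \<Rightarrow> real^'a) \<Rightarrow> real^'z" where
  "score \<theta> t z zh ah =
     (\<chi> i. deriv (\<lambda>u. ln (trans_density \<theta> t (\<chi> k. if k = i then u else z $ k) zh ah)) (z $ i))"

definition score_difference ::
    "('x::finite, 'z::finite, 'a::finite) latent_model \<Rightarrow> 'a \<Rightarrow> nat \<Rightarrow> real \<Rightarrow> nat \<Rightarrow> real^'z \<Rightarrow>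
     (nat \<Rightarrow> real^'z) \<Rightarrow> (nat \<Rightarrow> real^'a) \<Rightarrow> real^'z" where
  "score_difference \<theta> l \<tau> \<epsilon> t z zh ah =
     score \<theta> t z zh (ah(\<tau> := ah \<tau> + \<epsilon> *\<^sub>R axis l 1)) - score \<theta> t z zh ah"

definition sufficient_influence_a ::
    "nat \<Rightarrow> (real^'a) set \<Rightarrow> ('x::finite, 'z::finite, 'a::finite) latent_model \<Rightarrow> bool" where
  "sufficient_influence_a T \<A> \<theta> \<longleftrightarrow>
     (AE z in lborel. \<forall>l. \<exists>t \<tau> zh ah \<epsilon>.
        (\<forall>r\<in>{1..card (children_a \<theta> l)}.
           t r \<in> {1..T} \<and> \<tau> r < t r \<and> zh r \<in> z_hists (t r) \<and> ah r \<in> a_hists \<A> (t r) \<and>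
           ah r (\<tau> r) + \<epsilon> r *\<^sub>R axis l 1 \<in> \<A>) \<and>
        span ((\<lambda>r. score_difference \<theta> l (\<tau> r) (\<epsilon> r) (t r) z (zh r) (ah r)) `
              {1..card (children_a \<theta> l)})
          = coord_subspace (children_a \<theta> l))"

end

theory Submission
  imports Defs
begin

text \<open>
  The characteristic function of the observations is that of \<open>(f(z\<^sup>1), \<dots>, f(z\<^sup>T))\<close> times a
  nonvanishing Gaussian factor, so the law of the noise-free signal is identified.  Positivity
  of the densities and closedness of the images give \<open>range f = range f'\<close>, and the change of
  variables \<open>v = f\<inverse> \<circ> f'\<close> relates the densities of latent paths, first almost everywhere and
  then, by continuity, everywhere.  Integrating out the last latent vector descends in time and
  yields the transition densities one by one.

  Taking the partial difference in \<open>a\<close> of the logarithms removes \<open>\<bar>det Dv\<bar>\<close>, and the chain rule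
  maps the score differences of \<open>\<theta>\<close> at \<open>v z\<close> to those of \<open>\<theta>'\<close> at \<open>z\<close> by the transpose of
  \<open>Dv(z)\<close>.  The span condition on a dense set of points and continuity of \<open>Dv\<close> then force
  \<open>\<partial>v\<^sub>i/\<partial>z\<^sub>j = 0\<close> whenever some \<open>l\<close> has \<open>i\<close> but not \<open>j\<close> among its children in the respective
  graphs.  A nonzero term of \<open>det Dv(0)\<close> is the required permutation.
\<close>

text \<open>Three obstacles shape the route. Uniqueness of characteristic functions is applied to
  real random variables, while the joint law of all coordinates at all times is wanted; coordinates
  are therefore treated one at a time, with a nonnegative weight carrying the events already fixed
  and the oscillation in the coordinates still to come. Equality of laws fixes densities only up to
  null sets, whereas \<open>diff_equivalent\<close> and the scores are pointwise notions. The
  passage to every point is made once, for full paths, so that the last latent vector can afterwards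
  be integrated out for each fixed past. The span condition holds at points of the latent space of
  \<open>\<theta>\<close> and constrains \<open>Dv\<close> column by column: for a given
  \<open>l\<close>, a column whose index is no child of \<open>l\<close> in \<open>\<theta>'\<close>
  is orthogonal to the coordinate subspace of the children of \<open>l\<close> in
  \<open>\<theta>\<close>. This zero pattern mixes two graphs; once the graphs agree up to a
  permutation, it becomes preservation of a single graph.\<close>

subsection \<open>Change of variables over arbitrary finite index types\<close>

text \<open>
  The change of variables theorem of the library asks for a well-ordered index type.  Every
  finite type has a well-ordered copy, to which the theorem for arbitrary finite index types
  is transferred.
\<close>

typedef 'a well_ordered_copy = "UNIV :: 'a set" by simp

text \<open>Any injection into the naturals serves: pulling their order back along it gives a total
  well-founded order.\<close>

definition finite_index :: "'a::finite \<Rightarrow> nat" where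
  "finite_index = (SOME f. inj f)"

lemma inj_finite_index: "inj finite_index"
proof -
  obtain f :: "'a \<Rightarrow> nat" where "inj f"
    using finite_imp_inj_to_nat_seg[of "UNIV :: 'a set"] by auto
  then show ?thesis
    unfolding finite_index_def by (rule someI[where P = inj])
qed

instantiation well_ordered_copy :: (finite) "{finite, wellorder}"
begin

definition less_eq_well_ordered_copy :: "'a well_ordered_copy \<Rightarrow> 'a well_ordered_copy \<Rightarrow> bool" where
  "x \<le> y \<longleftrightarrow> finite_index (Rep_well_ordered_copy x) \<le> finite_index (Rep_well_ordered_copy y)"

definition less_well_ordered_copy :: "'a well_ordered_copy \<Rightarrow> 'a well_ordered_copy \<Rightarrow> bool" where
  "x < y \<longleftrightarrow> finite_index (Rep_well_ordered_copy x) < finite_index (Rep_well_ordered_copy y)"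

instance
proof
  have "range Abs_well_ordered_copy = (UNIV :: 'a well_ordered_copy set)"
    by (metis Rep_well_ordered_copy_inverse surjI)
  then show "finite (UNIV :: 'a well_ordered_copy set)"
    by (metis finite_imageI finite)
  fix x y z :: "'a well_ordered_copy"
  show "x \<le> y \<Longrightarrow> y \<le> x \<Longrightarrow> x = y"
    unfolding less_eq_well_ordered_copy_def
    by (meson Rep_well_ordered_copy_inject inj_finite_index injD order_antisym)
  show "P x" if "\<And>x. (\<And>y. y < x \<Longrightarrow> P y) \<Longrightarrow> P x" for P and x :: "'a well_ordered_copy"
    by (induction x rule: measure_induct_rule[where f = "\<lambda>x. finite_index (Rep_well_ordered_copy x)"])
       (use that in \<open>auto simp: less_well_ordered_copy_def\<close>)
qed (auto simp: less_eq_well_ordered_copy_def less_well_ordered_copy_def)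

end

lemma bij_Rep_well_ordered_copy: "bij Rep_well_ordered_copy"
  by (metis Abs_well_ordered_copy_inverse Rep_well_ordered_copy_inject UNIV_I bijI injI surjI)

lemma prod_Basis_cart: "(\<Prod>b\<in>Basis. (x :: real^'n) \<bullet> b) = (\<Prod>i\<in>UNIV. x $ i)"
proof -
  have "Basis = range (\<lambda>i::'n. axis i (1::real))"
    by (auto simp: Basis_vec_def)
  then have "(\<Prod>b\<in>Basis. x \<bullet> b) = (\<Prod>b\<in>range (\<lambda>i::'n. axis i (1::real)). x \<bullet> b)"
    by (rule arg_cong)
  also have "\<dots> = (\<Prod>i\<in>UNIV. x $ i)"
    by (subst prod.reindex) (auto simp: inj_on_def axis_eq_axis inner_axis)
  finally show ?thesis .
qed

text \<open>Conjugation by \<open>\<phi>\<close> matches the Leibniz terms of the two determinants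
  and preserves the sign of a permutation.\<close>

lemma det_reindex:
  fixes A :: "real^'n^'n" and \<phi> :: "'m::finite \<Rightarrow> 'n::finite"
  assumes \<phi>: "bij \<phi>"
  shows "det (\<chi> i j. A $ \<phi> i $ \<phi> j) = det A"
proof -
  have inj: "inj \<phi>" and inj': "inj (inv \<phi>)" and surj: "surj \<phi>"
    using \<phi> bij_imp_bij_inv bij_def by blast+
  have comp: "map_permutation UNIV \<phi> p = \<phi> \<circ> p \<circ> inv \<phi>" for p
    using surj by (simp add: map_permutation_def restrict_id_def fun_eq_iff)
  have comp': "map_permutation UNIV (inv \<phi>) p = inv \<phi> \<circ> p \<circ> \<phi>" for p
    using \<phi> by (simp add: map_permutation_def restrict_id_def fun_eq_iff inv_inv_eq bij_is_surj[OF bij_imp_bij_inv])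
  show ?thesis
    unfolding det_def
  proof (rule sum.reindex_bij_witness[where i = "map_permutation UNIV (inv \<phi>)" and j = "map_permutation UNIV \<phi>"])
    fix p assume p: "p \<in> {p. p permutes (UNIV :: 'm set)}"
    show "map_permutation UNIV (inv \<phi>) (map_permutation UNIV \<phi> p) = p"
      unfolding comp comp' using inj by (auto simp: fun_eq_iff)
    show "map_permutation UNIV \<phi> p \<in> {p. p permutes UNIV}"
      using map_permutation_permutes[of \<phi> UNIV UNIV p] p \<phi> by auto
    have s: "sign (map_permutation UNIV \<phi> p) = sign p"
      using p inj by (intro sign_map_permutation) auto
    have "(\<Prod>i\<in>UNIV. A $ i $ map_permutation UNIV \<phi> p i) = (\<Prod>i\<in>UNIV. A $ \<phi> i $ \<phi> (p i))"
      unfolding comp using prod.reindex_bij_betw[OF \<phi>, of "\<lambda>i. A $ i $ (\<phi> \<circ> p \<circ> inv \<phi>) i"] inj by simp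
    then show "of_int (sign (map_permutation UNIV \<phi> p)) * (\<Prod>i\<in>UNIV. A $ i $ map_permutation UNIV \<phi> p i) =
       of_int (sign p) * (\<Prod>i\<in>UNIV. (\<chi> i j. A $ \<phi> i $ \<phi> j) $ i $ p i)"
      using s by simp
  next
    fix p assume p: "p \<in> {p. p permutes (UNIV :: 'n set)}"
    show "map_permutation UNIV \<phi> (map_permutation UNIV (inv \<phi>) p) = p"
      unfolding comp comp' using surj by (auto simp: fun_eq_iff surj_f_inv_f)
    show "map_permutation UNIV (inv \<phi>) p \<in> {p. p permutes UNIV}"
      using map_permutation_permutes[of "inv \<phi>" UNIV UNIV p] p bij_imp_bij_inv[OF \<phi>] by auto
  qed
qed

text \<open>Boxes characterise Lebesgue measure, and relabelling turns a box into one with the same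
  side lengths in another order.\<close>

lemma lborel_distr_reindex:
  fixes \<phi> :: "'m::finite \<Rightarrow> 'n::finite"
  assumes \<phi>: "bij \<phi>"
  shows "distr lborel borel (\<lambda>x::real^'n. \<chi> k. x $ \<phi> k) = (lborel :: (real^'m) measure)"
proof (rule lborel_eqI[symmetric])
  let ?R = "\<lambda>x::real^'n. (\<chi> k. x $ \<phi> k) :: real^'m"
  have m: "?R \<in> borel_measurable borel"
    by (intro borel_measurable_continuous_onI continuous_intros)
  fix l u :: "real^'m"
  assume le: "\<And>b. b \<in> Basis \<Longrightarrow> l \<bullet> b \<le> u \<bullet> b"
  then have le': "l $ i \<le> u $ i" for i
    by (metis axis_in_Basis_iff Basis_real_def inner_axis inner_real_def insertI1 mult.right_neutral)
  let ?l = "(\<chi> i. l $ inv \<phi> i) :: real^'n" and ?u = "(\<chi> i. u $ inv \<phi> i) :: real^'n"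
  have "?R -` box l u = box ?l ?u"
    using \<phi> by (auto simp: mem_box_cart) (metis bij_inv_eq_iff)+
  then have "emeasure (distr lborel borel ?R) (box l u) = emeasure lborel (box ?l ?u)"
    using m by (simp add: emeasure_distr)
  also have "\<dots> = (\<Prod>b\<in>Basis. (?u - ?l) \<bullet> b)"
  proof (rule emeasure_lborel_box)
    fix b :: "real^'n" assume "b \<in> Basis"
    then obtain i where "b = axis i 1" by (auto simp: Basis_vec_def)
    then show "?l \<bullet> b \<le> ?u \<bullet> b" using le' by (simp add: inner_axis)
  qed
  also have "(\<Prod>b\<in>Basis. (?u - ?l) \<bullet> b) = (\<Prod>b\<in>Basis. (u - l) \<bullet> b)"
    unfolding prod_Basis_cart
    using prod.reindex_bij_betw[OF bij_imp_bij_inv[OF \<phi>], of "\<lambda>i. (u - l) $ i"] by simp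
  finally show "emeasure (distr lborel borel ?R) (box l u) = (\<Prod>b\<in>Basis. (u - l) \<bullet> b)" .
qed simp

text \<open>The measure whose density is the absolute Jacobian is pushed forward by \<open>v\<close>
  to Lebesgue measure. This needs checking on boxes only, so the change of variables theorem is
  applied to indicators of boxes; general \<open>h\<close> follows by integrating against equal
  measures.\<close>

lemma nn_integral_change_of_variables_wellorder:
  fixes v :: "real^'n::{finite,wellorder} \<Rightarrow> real^'n::{finite,wellorder}"
  assumes v: "\<And>x. (v has_derivative v' x) (at x)" and "bij v"
    and [measurable]: "(\<lambda>x. \<bar>det (matrix (v' x))\<bar>) \<in> borel_measurable borel" "h \<in> borel_measurable borel"
  shows "(\<integral>\<^sup>+x. h x \<partial>lborel) = (\<integral>\<^sup>+x. h (v x) * ennreal \<bar>det (matrix (v' x))\<bar> \<partial>lborel)"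
proof -
  let ?J = "\<lambda>x. \<bar>det (matrix (v' x))\<bar>"
  have "continuous_on UNIV v"
    using v by (meson continuous_at_imp_continuous_on has_derivative_continuous)
  then have [measurable]: "v \<in> borel_measurable borel"
    by (rule borel_measurable_continuous_onI)
  have "lborel = distr (density lborel (\<lambda>x. ennreal (?J x))) borel v"
  proof (rule lborel_eqI)
    fix l u :: "real^'n::{finite,wellorder}"
    assume le: "\<And>b. b \<in> Basis \<Longrightarrow> l \<bullet> b \<le> u \<bullet> b"
    let ?c = "measure lborel (box l u)"
    \<comment> \<open>\<open>has_absolute_integral_change_of_variables\<close> speaks of functions
      into a Cartesian power, so the indicator becomes a vector with one entry, which is extracted
      again at the end.\<close>
    let ?f = "\<lambda>x. (vec (indicator (box l u) x) :: real^1)"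
    have 1: "(indicator (box l u) :: real^'n::{finite,wellorder} \<Rightarrow> real) absolutely_integrable_on UNIV"
      "integral UNIV (indicator (box l u) :: real^'n::{finite,wellorder} \<Rightarrow> real) = ?c"
      by (auto simp: absolutely_integrable_on_def integrable_on_indicator lmeasure_integral_UNIV[symmetric]
          intro!: nonnegative_absolutely_integrable_1)
    have v1: "?f = (\<lambda>x. indicator (box l u) x *\<^sub>R 1)"
      by (auto simp: vec_eq_iff)
    have 2: "?f absolutely_integrable_on UNIV"
      unfolding v1 by (rule absolutely_integrable_scaleR_right[OF 1(1)])
    have 3: "integral UNIV ?f = ?c *\<^sub>R 1"
      unfolding v1 using 1(2) integral_linear[OF set_lebesgue_integral_eq_integral(1)[OF 1(1)]
        bounded_linear_scaleR_left[of "1 :: real^1"]]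
      by (simp add: o_def)
    have "(\<lambda>x. ?J x *\<^sub>R ?f (v x)) absolutely_integrable_on UNIV \<and>
           integral UNIV (\<lambda>x. ?J x *\<^sub>R ?f (v x)) = ?c *\<^sub>R 1"
      using has_absolute_integral_change_of_variables[of UNIV v v' ?f "?c *\<^sub>R 1"] v 2 3 \<open>bij v\<close>
      by (simp add: bij_is_surj bij_is_inj)
    then have "((\<lambda>x. ?J x *\<^sub>R ?f (v x)) has_integral ?c *\<^sub>R 1) UNIV"
      by (simp add: has_integral_iff set_lebesgue_integral_eq_integral(1))
    from has_integral_linear[OF this bounded_linear_vec_nth[of 1]]
    have "((\<lambda>x. ?J x * indicator (box l u) (v x)) has_integral ?c) UNIV"
      by (simp add: o_def)
    then have "(\<integral>\<^sup>+x. ennreal (?J x * indicator (box l u) (v x)) \<partial>lborel) = ?c"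
      by (intro nn_integral_has_integral_lborel) simp_all
    moreover have "emeasure (distr (density lborel (\<lambda>x. ennreal (?J x))) borel v) (box l u) =
        (\<integral>\<^sup>+x. ennreal (?J x * indicator (box l u) (v x)) \<partial>lborel)"
      using measurable_sets_borel[of v borel "box l u"]
      by (auto simp: emeasure_distr emeasure_density ennreal_mult' ennreal_indicator indicator_vimage
          intro!: nn_integral_cong)
    moreover have "ennreal ?c = (\<Prod>b\<in>Basis. (u - l) \<bullet> b)"
      using le emeasure_lborel_box[OF le] by (simp add: emeasure_eq_ennreal_measure)
    ultimately show "emeasure (distr (density lborel (\<lambda>x. ennreal (?J x))) borel v) (box l u) =
        (\<Prod>b\<in>Basis. (u - l) \<bullet> b)"
      by simp
  qed simp
  then have "(\<integral>\<^sup>+x. h x \<partial>lborel) = (\<integral>\<^sup>+x. h x \<partial>distr (density lborel (\<lambda>x. ennreal (?J x))) borel v)"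
    by simp
  also have "\<dots> = (\<integral>\<^sup>+x. h (v x) * ennreal (?J x) \<partial>lborel)"
    by (simp add: nn_integral_distr nn_integral_density mult.commute)
  finally show ?thesis .
qed

text \<open>\<open>R\<close> relabels coordinates by the well-ordered copy and \<open>S\<close>
  undoes it. The conjugate \<open>w\<close> of \<open>v\<close> has the Jacobian matrix of
  \<open>v\<close> with relabelled indices, so both measure and determinant survive the
  transfer.\<close>

lemma nn_integral_change_of_variables:
  fixes v :: "real^'n \<Rightarrow> real^'n"
  assumes v: "\<And>x. (v has_derivative v' x) (at x)" and "bij v"
    and [measurable]: "(\<lambda>x. \<bar>det (matrix (v' x))\<bar>) \<in> borel_measurable borel" "h \<in> borel_measurable borel"
  shows "(\<integral>\<^sup>+x. h x \<partial>lborel) = (\<integral>\<^sup>+x. h (v x) * ennreal \<bar>det (matrix (v' x))\<bar> \<partial>lborel)"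
proof -
  let ?J = "\<lambda>x. \<bar>det (matrix (v' x))\<bar>"
  let ?\<phi> = "Rep_well_ordered_copy :: 'n well_ordered_copy \<Rightarrow> 'n"
  note bij = bij_Rep_well_ordered_copy[where 'a = 'n]
  define R where "R x = (\<chi> k. x $ ?\<phi> k)" for x :: "real^'n"
  define S where "S y = (\<chi> i. y $ inv ?\<phi> i)" for y :: "real^'n well_ordered_copy"
  have RS: "R (S y) = y" "S (R x) = x" for x y
    using bij by (simp_all add: R_def S_def vec_eq_iff bij_is_inj bij_is_surj surj_f_inv_f)
  have lin: "linear R" "linear S"
    by (auto simp: linear_iff R_def S_def vec_eq_iff)
  then have [measurable]: "R \<in> borel_measurable borel" "S \<in> borel_measurable borel"
    by (auto intro!: borel_measurable_continuous_onI linear_continuous_on linear_conv_bounded_linear[THEN iffD1])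
  have "continuous_on UNIV v"
    using v by (meson continuous_at_imp_continuous_on has_derivative_continuous)
  then have [measurable]: "v \<in> borel_measurable borel"
    by (rule borel_measurable_continuous_onI)
  have dS: "distr lborel borel S = lborel"
    unfolding S_def using lborel_distr_reindex[OF bij_imp_bij_inv[OF bij]] .
  define w where "w = R \<circ> v \<circ> S"
  define w' where "w' y = R \<circ> v' (S y) \<circ> S" for y
  have dw: "(w has_derivative w' y) (at y)" for y
    unfolding w_def w'_def
    by (intro diff_chain_at linear_imp_has_derivative lin) (simp add: v)
  have det: "det (matrix (w' y)) = det (matrix (v' (S y)))" for y
  proof -
    have "S (axis k 1) = axis (?\<phi> k) 1" for k
      using bij by (auto simp: S_def axis_def vec_eq_iff bij_inv_eq_iff[OF bij] bij_is_inj)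
    then have "matrix (w' y) $ i $ j = (\<chi> i j. matrix (v' (S y)) $ ?\<phi> i $ ?\<phi> j) $ i $ j" for i j
      by (simp add: matrix_def w'_def R_def)
    then have "matrix (w' y) = (\<chi> i j. matrix (v' (S y)) $ ?\<phi> i $ ?\<phi> j)"
      unfolding vec_eq_iff by blast
    then show ?thesis using det_reindex[OF bij] by metis
  qed
  have "bij R" "bij S" by (rule bij_betw_byWitness[where f' = S] bij_betw_byWitness[where f' = R]; simp add: RS)+
  then have "bij w" unfolding w_def using \<open>bij v\<close> by (intro bij_comp)
  have "(\<integral>\<^sup>+x. h x \<partial>lborel) = (\<integral>\<^sup>+y. h (S y) \<partial>lborel)"
    by (subst dS[symmetric]) (simp add: nn_integral_distr)
  also have "\<dots> = (\<integral>\<^sup>+y. h (S (w y)) * ennreal \<bar>det (matrix (w' y))\<bar> \<partial>lborel)"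
    by (rule nn_integral_change_of_variables_wellorder[OF dw \<open>bij w\<close>]) (simp_all add: det)
  also have "\<dots> = (\<integral>\<^sup>+y. h (v (S y)) * ennreal (?J (S y)) \<partial>lborel)"
    by (simp add: w_def RS det[unfolded w_def])
  also have "\<dots> = (\<integral>\<^sup>+x. h (v x) * ennreal (?J x) \<partial>distr lborel borel S)"
    by (simp add: nn_integral_distr)
  finally show ?thesis unfolding dS .
qed

subsection \<open>Characteristic functions determine joint laws\<close>

lemma borel_measurable_cis [measurable]:
  "f \<in> borel_measurable M \<Longrightarrow> (\<lambda>x. cis (f x)) \<in> borel_measurable M"
  by (rule borel_measurable_continuous_on[where f = cis]) (simp_all add: continuous_on_cis)

lemma integrable_bounded_weight:
  fixes g :: "'a \<Rightarrow> complex"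
  assumes "finite_measure M" "g \<in> borel_measurable M" "\<And>x. norm (g x) \<le> C"
  shows "integrable M g"
  by (rule finite_measure.integrable_const_bound[where B = C]) (use assms in auto)

text \<open>Setting \<open>u = 0\<close> shows that both weights have the same total mass
  \<open>c\<close>. After division by \<open>c\<close> the hypothesis compares characteristic
  functions of two laws on the line, and \<open>Levy_uniqueness\<close> applies. The weights allow
  conditions on other coordinates to be carried along.\<close>

lemma integral_exp_determines_weighted_measure:
  fixes X W :: "'m \<Rightarrow> real" and X' W' :: "'n \<Rightarrow> real"
  assumes M: "finite_measure M" and M': "finite_measure M'"
    and [measurable]: "X \<in> borel_measurable M" "W \<in> borel_measurable M"
      "X' \<in> borel_measurable M'" "W' \<in> borel_measurable M'"
    and W: "\<And>x. 0 \<le> W x" "\<And>x. W x \<le> C" and W': "\<And>x. 0 \<le> W' x" "\<And>x. W' x \<le> C'"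
    and eq: "\<And>u. (LINT x|M. of_real (W x) * cis (u * X x)) = (LINT x|M'. of_real (W' x) * cis (u * X' x))"
    and [measurable]: "A \<in> sets borel"
  shows "(LINT x|M. W x * indicator A (X x)) = (LINT x|M'. W' x * indicator A (X' x))"
proof -
  interpret M: finite_measure M by fact
  interpret M': finite_measure M' by fact
  have iW: "integrable M W"
    by (rule M.integrable_const_bound[where B = C]) (use W in auto)
  have iW': "integrable M' W'"
    by (rule M'.integrable_const_bound[where B = C']) (use W' in auto)
  define c where "c = (LINT x|M. W x)"
  have "of_real c = (of_real (LINT x|M'. W' x) :: complex)"
    using eq[of 0] by (simp add: c_def)
  then have c': "(LINT x|M'. W' x) = c" by (simp only: of_real_eq_iff)
  have c0: "0 \<le> c" unfolding c_def using W by simp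
  show ?thesis
  proof (cases "c = 0")
    case True
    \<comment> \<open>With no mass there is nothing to normalise, but then both weights vanish
      almost everywhere.\<close>
    have "AE x in M. W x = 0"
      using True iW W(1) by (simp add: c_def integral_nonneg_eq_0_iff_AE)
    then have 1: "(LINT x|M. W x * indicator A (X x)) = 0"
      by (intro integral_eq_zero_AE) auto
    have "AE x in M'. W' x = 0"
      using True iW' W'(1) c' by (simp add: integral_nonneg_eq_0_iff_AE)
    then have "(LINT x|M'. W' x * indicator A (X' x)) = 0"
      by (intro integral_eq_zero_AE) auto
    with 1 show ?thesis by simp
  next
    case False
    with c0 have cpos: "0 < c" by simp
    \<comment> \<open>Stated for a generic measure because \<open>M\<close> and \<open>M'\<close>
      may live on different types.\<close>
    have key: "real_distribution (distr (density N (\<lambda>x. ennreal (V x / c))) borel Y) \<and>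
        char (distr (density N (\<lambda>x. ennreal (V x / c))) borel Y) =
          (\<lambda>u. (LINT x|N. of_real (V x) * cis (u * Y x)) / of_real c) \<and>
        measure (distr (density N (\<lambda>x. ennreal (V x / c))) borel Y) A
          = (LINT x|N. V x * indicator A (Y x)) / c"
      if [measurable]: "Y \<in> borel_measurable N" "V \<in> borel_measurable N"
        and V: "\<And>x. 0 \<le> V x" and iV: "integrable N V" and ic: "(LINT x|N. V x) = c"
      for N :: "'k measure" and V Y
    proof (intro conjI)
      let ?D = "density N (\<lambda>x. ennreal (V x / c))"
      have nn: "0 \<le> V x / c" for x using V[of x] cpos by simp
      have "emeasure ?D (space ?D) = (\<integral>\<^sup>+x. ennreal (V x / c) \<partial>N)"
        by (subst emeasure_density) (auto intro!: nn_integral_cong)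
      also have "\<dots> = ennreal (LINT x|N. V x / c)"
        by (rule nn_integral_eq_integral) (use iV nn in auto)
      also have "\<dots> = 1" using ic cpos by simp
      finally interpret D: prob_space ?D by (rule prob_spaceI)
      have Ym: "Y \<in> borel_measurable ?D" by simp
      show "real_distribution (distr ?D borel Y)"
        using D.prob_space_distr[OF Ym] by (simp add: real_distribution_def real_distribution_axioms_def)
      show "char (distr ?D borel Y) = (\<lambda>u. (LINT x|N. of_real (V x) * cis (u * Y x)) / of_real c)"
      proof
        fix u
        have "char (distr ?D borel Y) u = (CLINT x|?D. iexp (u * Y x))"
          unfolding char_def by (subst integral_distr) simp_all
        also have "\<dots> = (CLINT x|N. (V x / c) *\<^sub>R iexp (u * Y x))"
          by (subst integral_density) (use nn in auto)
        also have "\<dots> = (CLINT x|N. of_real (V x) * cis (u * Y x) / of_real c)"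
          by (intro Bochner_Integration.integral_cong) (simp_all add: cis_conv_exp scaleR_conv_of_real)
        finally show "char (distr ?D borel Y) u = (LINT x|N. of_real (V x) * cis (u * Y x)) / of_real c"
          by simp
      qed
      have "measure (distr ?D borel Y) A = (LINT x|distr ?D borel Y. indicator A x)"
        by simp
      also have "\<dots> = (LINT x|?D. indicator A (Y x))"
        by (subst integral_distr) simp_all
      also have "\<dots> = (LINT x|N. (V x / c) * indicator A (Y x))"
        by (subst integral_density) (use nn in auto)
      also have "\<dots> = (LINT x|N. V x * indicator A (Y x)) / c"
        by simp
      finally show "measure (distr ?D borel Y) A = (LINT x|N. V x * indicator A (Y x)) / c" .
    qed
    note k = key[of X M W] key[of X' M' W']
    have "distr (density M (\<lambda>x. ennreal (W x / c))) borel X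
        = distr (density M' (\<lambda>x. ennreal (W' x / c))) borel X'"
      by (rule Levy_uniqueness) (use k W W' iW iW' c' c_def eq in auto)
    then have "(LINT x|M. W x * indicator A (X x)) / c = (LINT x|M'. W' x * indicator A (X' x)) / c"
      using k W W' iW iW' c' c_def by auto
    then show ?thesis using cpos by simp
  qed
qed

text \<open>For a new coordinate \<open>k\<close> the scalar lemma inserts the indicator of
  \<open>B k\<close>, while the oscillation in the other coordinates sits in the weight. The
  indicator is then absorbed into the weight for the induction hypothesis, which is why the weights
  are arbitrary in the induction.\<close>

lemma integral_exp_sum_determines_boxes:
  fixes X :: "'k \<Rightarrow> 'm \<Rightarrow> real" and X' :: "'k \<Rightarrow> 'n \<Rightarrow> real"
    and W :: "'m \<Rightarrow> real" and W' :: "'n \<Rightarrow> real"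
  assumes M: "finite_measure M" and M': "finite_measure M'" and "finite K"
    and "\<And>k. k \<in> K \<Longrightarrow> X k \<in> borel_measurable M" "\<And>k. k \<in> K \<Longrightarrow> X' k \<in> borel_measurable M'"
    and "W \<in> borel_measurable M" "W' \<in> borel_measurable M'"
    and "\<And>x. 0 \<le> W x" "\<And>x. W x \<le> C" "\<And>x. 0 \<le> W' x" "\<And>x. W' x \<le> C'"
    and "\<And>u. (LINT x|M. of_real (W x) * cis (\<Sum>k\<in>K. u k * X k x)) =
          (LINT x|M'. of_real (W' x) * cis (\<Sum>k\<in>K. u k * X' k x))"
    and "\<And>k. k \<in> K \<Longrightarrow> B k \<in> sets borel"
  shows "(LINT x|M. W x * (\<Prod>k\<in>K. indicator (B k) (X k x))) =
         (LINT x|M'. W' x * (\<Prod>k\<in>K. indicator (B k) (X' k x)))"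
  using assms(3-)
proof (induction K arbitrary: W W' rule: finite_induct)
  case empty
  from empty.prems(9)[of undefined] show ?case
    by simp
next
  case (insert k K)
  interpret M: finite_measure M by fact
  interpret M': finite_measure M' by fact
  have [measurable]: "X k \<in> borel_measurable M" "\<And>j. j \<in> K \<Longrightarrow> X j \<in> borel_measurable M"
    "X' k \<in> borel_measurable M'" "\<And>j. j \<in> K \<Longrightarrow> X' j \<in> borel_measurable M'"
    "W \<in> borel_measurable M" "W' \<in> borel_measurable M'" "B k \<in> sets borel"
    using insert.prems by auto
  note W = insert.prems(5,6) and W' = insert.prems(7,8)
  have nW: "\<bar>W x\<bar> \<le> C" "\<bar>W' y\<bar> \<le> C'" for x y
    using W[of x] W'[of y] by auto
  define Y where "Y u x = (\<Sum>j\<in>K. u j * X j x)" for u x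
  define Y' where "Y' u x = (\<Sum>j\<in>K. u j * X' j x)" for u x
  have [measurable]: "Y u \<in> borel_measurable M" "Y' u \<in> borel_measurable M'" for u
    unfolding Y_def Y'_def by measurable
  have iM: "integrable M (\<lambda>x. of_real (W x) * cis (g x))" if [measurable]: "g \<in> borel_measurable M" for g
    by (rule integrable_bounded_weight[OF M, where C = C]) (use nW in \<open>auto simp: norm_mult\<close>)
  have iM': "integrable M' (\<lambda>x. of_real (W' x) * cis (g x))" if [measurable]: "g \<in> borel_measurable M'" for g
    by (rule integrable_bounded_weight[OF M', where C = C']) (use nW in \<open>auto simp: norm_mult\<close>)
  have eq: "(LINT x|M. of_real (W x) * cis (s * X k x + Y u x)) =
      (LINT x|M'. of_real (W' x) * cis (s * X' k x + Y' u x))" for s u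
  proof -
    have "(\<Sum>j\<in>insert k K. (u(k := s)) j * Z j) = s * Z k + (\<Sum>j\<in>K. u j * Z j)" for Z :: "'k \<Rightarrow> real"
      using insert.hyps by (simp) (intro sum.cong, auto)
    then show ?thesis
      using insert.prems(9)[of "u(k := s)"] by (simp add: Y_def Y'_def)
  qed
  have eq0: "(LINT x|M. of_real (W x) * cis (s * X k x)) = (LINT x|M'. of_real (W' x) * cis (s * X' k x))" for s
    using eq[of s "\<lambda>_. 0"] by (simp add: Y_def Y'_def)
  \<comment> \<open>\<open>1 + cos\<close> keeps the weight nonnegative, so the scalar case applies; the real and imaginary
    parts of \<open>cis (Y u x)\<close> are recovered with \<open>a = 0\<close> and \<open>a = - pi / 2\<close>.\<close>
  have shift: "(LINT x|M. W x * (1 + cos (Y u x + a)) * indicator (B k) (X k x)) =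
      (LINT x|M'. W' x * (1 + cos (Y' u x + a)) * indicator (B k) (X' k x))" for u a
  proof (rule integral_exp_determines_weighted_measure[OF M M', where C = "C * 2" and C' = "C' * 2"])
    have C0: "0 \<le> C" "0 \<le> C'" using nW by (meson abs_ge_zero order_trans)+
    have c: "0 \<le> 1 + cos t" "1 + cos t \<le> 2" for t :: real
      using cos_ge_minus_one[of t] cos_le_one[of t] by linarith+
    show "0 \<le> W x * (1 + cos (Y u x + a))" "0 \<le> W' y * (1 + cos (Y' u y + a))" for x y
      using W W' c by simp_all
    show "W x * (1 + cos (Y u x + a)) \<le> C * 2" "W' y * (1 + cos (Y' u y + a)) \<le> C' * 2" for x y
      using W W' c C0 by (simp_all add: mult_mono)
    fix s
    \<comment> \<open>Euler's formula: the weight merely shifts the frequencies on \<open>K\<close>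
      to \<open>0\<close>, \<open>u\<close> or \<open>- u\<close>, and the hypothesis covers each of
      them.\<close>
    have split: "of_real (w * (1 + cos (y + a))) * cis z =
       of_real w * cis z + cis a / 2 * (of_real w * cis (z + y)) + cis (- a) / 2 * (of_real w * cis (z - y))"
      for w y z :: real
      by (auto simp: complex_eq_iff cos_add sin_add cos_diff sin_diff field_simps)
    have mu: "Y (\<lambda>j. - u j) x = - Y u x" "Y' (\<lambda>j. - u j) y = - Y' u y" for x y
      by (simp_all add: Y_def Y'_def sum_negf)
    have e2: "(LINT x|M. of_real (W x) * cis (s * X k x - Y u x)) =
      (LINT x|M'. of_real (W' x) * cis (s * X' k x - Y' u x))"
      using eq[of s "\<lambda>j. - u j"] by (simp add: mu)
    show "(LINT x|M. of_real (W x * (1 + cos (Y u x + a))) * cis (s * X k x)) =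
      (LINT x|M'. of_real (W' x * (1 + cos (Y' u x + a))) * cis (s * X' k x))"
      unfolding split
      by (simp add: iM iM' eq eq0 e2)
  qed auto
  have eqB: "(LINT x|M. W x * indicator (B k) (X k x)) = (LINT x|M'. W' x * indicator (B k) (X' k x))"
    by (rule integral_exp_determines_weighted_measure[OF M M', where C = C and C' = C'])
       (use W W' eq0 in auto)
  have cosB: "(LINT x|M. W x * indicator (B k) (X k x) * cos (Y u x + a)) =
      (LINT x|M'. W' x * indicator (B k) (X' k x) * cos (Y' u x + a))" for u a
  proof -
    have bd: "\<bar>w * indicator D y * cos t\<bar> \<le> c" if "\<bar>w\<bar> \<le> c" for w c t y :: real and D
      using mult_mono[OF that abs_cos_le_one[of t]] that by (auto simp: abs_mult indicator_def)
    have i: "integrable M (\<lambda>x. W x * indicator (B k) (X k x) * cos (Y u x + a))"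
      "integrable M' (\<lambda>x. W' x * indicator (B k) (X' k x) * cos (Y' u x + a))"
      "integrable M (\<lambda>x. W x * indicator (B k) (X k x))"
      "integrable M' (\<lambda>x. W' x * indicator (B k) (X' k x))"
      by (rule M.integrable_const_bound[where B = C] M'.integrable_const_bound[where B = C'];
          simp add: bd[OF nW(1)] bd[OF nW(2)] bd[OF nW(1), of _ _ _ 0, simplified] bd[OF nW(2), of _ _ _ 0, simplified])+
    \<comment> \<open>The constant 1 of the weight contributes exactly \<open>eqB\<close>, so it can
      be subtracted once all parts are known to be integrable.\<close>
    have "(LINT x|M. W x * indicator (B k) (X k x) + W x * indicator (B k) (X k x) * cos (Y u x + a)) =
      (LINT x|M'. W' x * indicator (B k) (X' k x) + W' x * indicator (B k) (X' k x) * cos (Y' u x + a))"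
      using shift[of u a] by (simp add: algebra_simps)
    then show ?thesis using i eqB by simp
  qed
  have "(LINT x|M. (W x * indicator (B k) (X k x)) * (\<Prod>k\<in>K. indicator (B k) (X k x))) =
         (LINT x|M'. (W' x * indicator (B k) (X' k x)) * (\<Prod>k\<in>K. indicator (B k) (X' k x)))"
  proof (rule insert.IH)
    fix u
    let ?V = "\<lambda>x. W x * indicator (B k) (X k x)" and ?V' = "\<lambda>x. W' x * indicator (B k) (X' k x)"
    have i: "integrable M (\<lambda>x. of_real (?V x) * cis (Y u x))" "integrable M' (\<lambda>x. of_real (?V' x) * cis (Y' u x))"
      by (rule integrable_bounded_weight[OF M, where C = C] integrable_bounded_weight[OF M', where C = C'];
         use nW in \<open>auto simp: norm_mult indicator_def dest: order_trans[OF abs_ge_zero]\<close>)+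
    have "(LINT x|M. of_real (?V x) * cis (Y u x)) = (LINT x|M'. of_real (?V' x) * cis (Y' u x))"
    proof (rule complex_eqI)
      show "Re (LINT x|M. of_real (?V x) * cis (Y u x)) = Re (LINT x|M'. of_real (?V' x) * cis (Y' u x))"
        using cosB[of u 0] i by (simp flip: integral_Re)
      show "Im (LINT x|M. of_real (?V x) * cis (Y u x)) = Im (LINT x|M'. of_real (?V' x) * cis (Y' u x))"
        using cosB[of u "- pi / 2"] i by (simp add: cos_diff flip: integral_Im)
    qed
    then show "(LINT x|M. of_real (?V x) * cis (\<Sum>k\<in>K. u k * X k x)) = (LINT x|M'. of_real (?V' x) * cis (\<Sum>k\<in>K. u k * X' k x))"
      by (simp add: Y_def Y'_def)
    have C0: "0 \<le> C" "0 \<le> C'" using nW by (meson abs_ge_zero order_trans)+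
    show "?V x \<le> C" "?V' y \<le> C'" for x y
      using W W' C0 by (simp_all add: indicator_def)
  qed (use insert.prems in auto)
  then show ?case
    using insert.hyps by (simp add: mult.assoc)
qed

subsection \<open>Removing independent Gaussian noise\<close>

lemma borel_measurable_vec_nth [measurable (raw)]:
  fixes f :: "'m \<Rightarrow> real^'n"
  shows "f \<in> borel_measurable M \<Longrightarrow> (\<lambda>x. f x $ i) \<in> borel_measurable M"
  by (rule borel_measurable_continuous_on[where f = "\<lambda>x. x $ i"]) (auto intro!: continuous_intros)

lemma borel_measurable_vec_lambda [measurable (raw)]:
  fixes f :: "'n::finite \<Rightarrow> 'm \<Rightarrow> real"
  assumes "\<And>i. f i \<in> borel_measurable M"
  shows "(\<lambda>x. \<chi> i. f i x) \<in> borel_measurable M"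
  unfolding borel_measurable_euclidean_space[of "\<lambda>x. \<chi> i. f i x"]
  using assms by (auto simp: Basis_vec_def inner_axis)

lemma cis_sum: "finite I \<Longrightarrow> cis (\<Sum>i\<in>I. f i) = (\<Prod>i\<in>I. cis (f i))"
  by (induction I rule: finite_induct) (simp_all flip: cis_mult)

lemma sets_gaussian_noise [simp, measurable_cong]: "sets (gaussian_noise \<sigma>2) = sets borel"
  by (simp add: gaussian_noise_def)

lemma prob_space_gaussian_noise: "prob_space (gaussian_noise \<sigma>2)"
proof -
  interpret product_prob_space "\<lambda>_. std_normal_distribution" "UNIV :: 'a set"
    by (rule product_prob_spaceI) (simp add: prob_space_normal_density)
  show ?thesis
    unfolding gaussian_noise_def by (rule prob_space_distr) simp
qed

text \<open>By independence of the coordinates the integral is a product of values of the standard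
  normal characteristic function, an exponential without zeros. For \<open>\<sigma>2 = 0\<close> it
  is evaluated at 0.\<close>

lemma gaussian_noise_exp:
  fixes c :: "'x::finite \<Rightarrow> real"
  shows "(LINT n|gaussian_noise \<sigma>2. cis (\<Sum>i\<in>UNIV. c i * n $ i)) \<noteq> 0"
proof -
  interpret product_prob_space "\<lambda>_. std_normal_distribution" "UNIV :: 'x set"
    by (rule product_prob_spaceI) (simp add: prob_space_normal_density)
  have int: "integrable std_normal_distribution (\<lambda>w. cis (t * w))" for t
    by (rule integrable_bounded_weight[where C = 1])
       (auto simp: prob_space.finite_measure[OF prob_space_normal_density])
  have "(LINT n|gaussian_noise \<sigma>2. cis (\<Sum>i\<in>UNIV. c i * n $ i)) =
      (LINT w|(\<Pi>\<^sub>M i\<in>(UNIV::'x set). std_normal_distribution). (\<Prod>i\<in>UNIV. cis (c i * sqrt \<sigma>2 * w i)))"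
    unfolding gaussian_noise_def
    by (subst integral_distr) (simp_all add: cis_sum mult.assoc)
  also have "\<dots> = (\<Prod>i\<in>UNIV. LINT w|std_normal_distribution. cis (c i * sqrt \<sigma>2 * w))"
    by (rule product_integral_prod) (simp_all add: int)
  also have "\<dots> = (\<Prod>i\<in>UNIV. char std_normal_distribution (c i * sqrt \<sigma>2))"
    by (simp add: char_def cis_conv_exp)
  also have "\<dots> \<noteq> 0"
    by (simp add: char_std_normal_distribution)
  finally show ?thesis .
qed

lemma integral_pair_mult:
  fixes g h :: "_ \<Rightarrow> complex"
  assumes M: "prob_space M" and N: "prob_space N"
    and [measurable]: "g \<in> borel_measurable M" "h \<in> borel_measurable N"
    and bd: "\<And>x. norm (g x) \<le> 1" "\<And>y. norm (h y) \<le> 1"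
  shows "(LINT z|(M \<Otimes>\<^sub>M N). g (fst z) * h (snd z)) = (LINT x|M. g x) * (LINT y|N. h y)"
proof -
  interpret M: prob_space M by fact
  interpret N: prob_space N by fact
  interpret pair_prob_space M N ..
  have "integrable (M \<Otimes>\<^sub>M N) (\<lambda>z. g (fst z) * h (snd z))"
    by (rule integrable_bounded_weight[where C = 1])
       (use bd in \<open>auto simp: norm_mult mult_le_one intro: finite_measure_axioms\<close>)
  from integral_fst'[OF this] show ?thesis by simp
qed

text \<open>The noise is independent of the signal and has the same law on both sides, so the common
  factor \<open>\<nu> u\<close> cancels. Vectors are flattened to real coordinates indexed by pairs
  of time and component, the form required by
  \<open>integral_exp_sum_determines_boxes\<close>.\<close>

lemma gaussian_deconvolution:
  fixes g g' :: "'m \<Rightarrow> nat \<Rightarrow> real^'x::finite"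
  assumes L: "prob_space L" and L': "prob_space L'" and I: "finite I"
    and g: "\<And>t. t \<in> I \<Longrightarrow> (\<lambda>z. g z t) \<in> borel_measurable L"
    and g': "\<And>t. t \<in> I \<Longrightarrow> (\<lambda>z. g' z t) \<in> borel_measurable L'"
    and eq: "distr (L \<Otimes>\<^sub>M (\<Pi>\<^sub>M t\<in>I. gaussian_noise \<sigma>2)) (\<Pi>\<^sub>M t\<in>I. borel) (\<lambda>(z, n). \<lambda>t\<in>I. g z t + n t) =
      distr (L' \<Otimes>\<^sub>M (\<Pi>\<^sub>M t\<in>I. gaussian_noise \<sigma>2)) (\<Pi>\<^sub>M t\<in>I. borel) (\<lambda>(z, n). \<lambda>t\<in>I. g' z t + n t)"
  shows "distr L (\<Pi>\<^sub>M t\<in>I. borel) (\<lambda>z. \<lambda>t\<in>I. g z t) = distr L' (\<Pi>\<^sub>M t\<in>I. borel) (\<lambda>z. \<lambda>t\<in>I. g' z t)"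
proof -
  let ?N = "\<Pi>\<^sub>M t\<in>I. (gaussian_noise \<sigma>2 :: (real^'x) measure)"
  let ?K = "I \<times> (UNIV :: 'x set)"
  interpret L: prob_space L by fact
  interpret L': prob_space L' by fact
  interpret N: product_prob_space "\<lambda>_. gaussian_noise \<sigma>2 :: (real^'x) measure" I
    by (rule product_prob_spaceI) (rule prob_space_gaussian_noise)
  have probN: "prob_space ?N" by unfold_locales
  define \<nu> where "\<nu> u = (LINT n|?N. cis (\<Sum>k\<in>?K. u k * n (fst k) $ snd k))" for u :: "nat \<times> 'x \<Rightarrow> real"
  \<comment> \<open>Independence across time splits \<open>\<nu> u\<close> into one factor per time,
    each nonzero by \<open>gaussian_noise_exp\<close>.\<close>
  have \<nu>: "\<nu> u \<noteq> 0" for u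
  proof -
    have "(\<lambda>n. cis (\<Sum>k\<in>?K. u k * n (fst k) $ snd k)) =
        (\<lambda>n::nat \<Rightarrow> real^'x. \<Prod>t\<in>I. cis (\<Sum>i\<in>UNIV. u (t, i) * n t $ i))"
      using I by (simp add: cis_sum prod.cartesian_product split_def)
    then have "\<nu> u = (\<Prod>t\<in>I. LINT n|gaussian_noise \<sigma>2. cis (\<Sum>i\<in>(UNIV::'x set). u (t, i) * n $ i))"
      unfolding \<nu>_def using I
      by (simp, subst N.product_integral_prod)
         (auto intro!: integrable_bounded_weight[where C = 1] prob_space.finite_measure prob_space_gaussian_noise)
    then show ?thesis
      using I gaussian_noise_exp[of \<sigma>2 "\<lambda>i. u (t, i)" for t] by simp
  qed
  have conv: "(LINT x|distr (Q \<Otimes>\<^sub>M ?N) (\<Pi>\<^sub>M t\<in>I. borel) (\<lambda>(z, n). \<lambda>t\<in>I. h z t + n t).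
        cis (\<Sum>k\<in>?K. u k * x (fst k) $ snd k)) = (LINT z|Q. cis (\<Sum>k\<in>?K. u k * h z (fst k) $ snd k)) * \<nu> u"
    if Q: "prob_space Q" and h[measurable]: "\<And>t. t \<in> I \<Longrightarrow> (\<lambda>z. h z t) \<in> borel_measurable Q"
    for Q :: "'m measure" and h :: "'m \<Rightarrow> nat \<Rightarrow> real^'x" and u
  proof -
    have [measurable]: "(\<lambda>z. cis (\<Sum>k\<in>?K. u k * h z (fst k) $ snd k)) \<in> borel_measurable Q"
      "(\<lambda>n. cis (\<Sum>k\<in>?K. u k * n (fst k) $ snd k)) \<in> borel_measurable ?N"
      by (intro borel_measurable_cis borel_measurable_sum borel_measurable_times borel_measurable_const
           borel_measurable_vec_nth h; auto)+
    have "(LINT x|distr (Q \<Otimes>\<^sub>M ?N) (\<Pi>\<^sub>M t\<in>I. borel) (\<lambda>(z, n). \<lambda>t\<in>I. h z t + n t).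
        cis (\<Sum>k\<in>?K. u k * x (fst k) $ snd k)) =
      (LINT y|(Q \<Otimes>\<^sub>M ?N). cis (\<Sum>k\<in>?K. u k * (\<lambda>(z, n). \<lambda>t\<in>I. h z t + n t) y (fst k) $ snd k))"
    proof (rule integral_distr)
      show "(\<lambda>(z, n). \<lambda>t\<in>I. h z t + n t) \<in> Q \<Otimes>\<^sub>M ?N \<rightarrow>\<^sub>M (\<Pi>\<^sub>M t\<in>I. borel)"
        by measurable
      show "(\<lambda>x. cis (\<Sum>k\<in>?K. u k * x (fst k) $ snd k)) \<in> borel_measurable (\<Pi>\<^sub>M t\<in>I. borel)"
        by (intro borel_measurable_cis borel_measurable_sum borel_measurable_times borel_measurable_const
           borel_measurable_vec_nth; auto)
    qed
    also have "\<dots> = (LINT y|(Q \<Otimes>\<^sub>M ?N). cis (\<Sum>k\<in>?K. u k * h (fst y) (fst k) $ snd k) *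
         cis (\<Sum>k\<in>?K. u k * (snd y) (fst k) $ snd k))"
      by (intro Bochner_Integration.integral_cong)
         (auto simp: split_def cis_mult sum.distrib[symmetric] algebra_simps intro!: arg_cong[where f = cis] sum.cong)
    also have "\<dots> = (LINT z|Q. cis (\<Sum>k\<in>?K. u k * h z (fst k) $ snd k)) * \<nu> u"
      unfolding \<nu>_def by (rule integral_pair_mult) (simp_all add: Q probN)
    finally show ?thesis .
  qed
  have cf: "(LINT z|L. cis (\<Sum>k\<in>?K. u k * g z (fst k) $ snd k)) =
      (LINT z|L'. cis (\<Sum>k\<in>?K. u k * g' z (fst k) $ snd k))" for u
    using conv[of L g u, OF L g] conv[of L' g' u, OF L' g'] eq \<nu>[of u] by simp
  have box: "measure L {z\<in>space L. \<forall>k\<in>?K. g z (fst k) $ snd k \<in> B k} =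
     measure L' {z\<in>space L'. \<forall>k\<in>?K. g' z (fst k) $ snd k \<in> B k}"
    if B: "\<And>k. k \<in> ?K \<Longrightarrow> B k \<in> sets borel" for B
  proof -
    have ind: "(LINT z|Q. 1 * (\<Prod>k\<in>?K. indicator (B k) (h z (fst k) $ snd k))) =
        measure Q {z\<in>space Q. \<forall>k\<in>?K. h z (fst k) $ snd k \<in> B k}"
      if h[measurable]: "\<And>t. t \<in> I \<Longrightarrow> (\<lambda>z. h z t) \<in> borel_measurable Q"
      for Q :: "'m measure" and h :: "'m \<Rightarrow> nat \<Rightarrow> real^'x"
    proof -
      have "(LINT z|Q. 1 * (\<Prod>k\<in>?K. indicator (B k) (h z (fst k) $ snd k) :: real)) =
        (LINT z|Q. indicator {z\<in>space Q. \<forall>k\<in>?K. h z (fst k) $ snd k \<in> B k} z)"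
        using I by (intro Bochner_Integration.integral_cong) (auto simp: indicator_def intro!: prod.neutral)
      then show ?thesis by (simp add: Int_absorb2 subset_iff)
    qed
    have "(LINT z|L. 1 * (\<Prod>k\<in>?K. indicator (B k) (g z (fst k) $ snd k) :: real)) =
          (LINT z|L'. 1 * (\<Prod>k\<in>?K. indicator (B k) (g' z (fst k) $ snd k)))"
    proof (rule integral_exp_sum_determines_boxes[where C = 1 and C' = 1])
      show "finite_measure L" "finite_measure L'" by unfold_locales
      fix u show "(LINT x|L. complex_of_real 1 * cis (\<Sum>k\<in>?K. u k * g x (fst k) $ snd k)) =
         (LINT x|L'. complex_of_real 1 * cis (\<Sum>k\<in>?K. u k * g' x (fst k) $ snd k))"
        using cf[of u] by simp
    qed (use I B g g' in auto)
    then show ?thesis using ind[of g L] ind[of g' L'] g g' by simp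
  qed
  define X where "X h z = (\<lambda>k\<in>?K. h z (fst k) $ snd k)" for h :: "'m \<Rightarrow> nat \<Rightarrow> real^'x" and z
  have Xm: "X h \<in> Q \<rightarrow>\<^sub>M (\<Pi>\<^sub>M k\<in>?K. borel)" if "\<And>t. t \<in> I \<Longrightarrow> (\<lambda>z. h z t) \<in> borel_measurable Q" for Q h
    unfolding X_def using that by (intro measurable_restrict) auto
  have XL: "X g \<in> L \<rightarrow>\<^sub>M (\<Pi>\<^sub>M k\<in>?K. borel)" and XL': "X g' \<in> L' \<rightarrow>\<^sub>M (\<Pi>\<^sub>M k\<in>?K. borel)"
    by (rule Xm, use g g' in simp)+
  \<comment> \<open>Boxes generate the product sigma-algebra and are stable under intersection, so
    agreement of these finite measures on boxes suffices.\<close>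
  have distrX: "distr L (\<Pi>\<^sub>M k\<in>?K. borel) (X g) = distr L' (\<Pi>\<^sub>M k\<in>?K. borel) (X g')"
  proof (rule measure_eqI_PiM_finite[where I = ?K])
    fix A :: "nat \<times> 'x \<Rightarrow> real set" assume A: "\<And>k. k \<in> ?K \<Longrightarrow> A k \<in> sets borel"
    have box': "Pi\<^sub>E ?K A \<in> sets (\<Pi>\<^sub>M k\<in>?K. borel)"
      using A I by (intro sets_PiM_I_finite) auto
    have pre: "X h -` Pi\<^sub>E ?K A \<inter> S = {z\<in>S. \<forall>k\<in>?K. h z (fst k) $ snd k \<in> A k}" for h S
      by (auto simp: X_def PiE_iff)
    show "emeasure (distr L (\<Pi>\<^sub>M k\<in>?K. borel) (X g)) (Pi\<^sub>E ?K A) =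
        emeasure (distr L' (\<Pi>\<^sub>M k\<in>?K. borel) (X g')) (Pi\<^sub>E ?K A)"
      using box[of A] A
      by (simp add: emeasure_distr XL XL' box' pre L.emeasure_eq_measure L'.emeasure_eq_measure)
  next
    show "range (\<lambda>_::nat. \<Pi>\<^sub>E k\<in>?K. UNIV) \<subseteq> prod_algebra ?K (\<lambda>_. borel :: real measure)"
      using I by (auto intro!: prod_algebraI_finite)
    interpret D: prob_space "distr L (\<Pi>\<^sub>M k\<in>?K. borel) (X g)"
      using XL by (rule L.prob_space_distr)
    show "emeasure (distr L (\<Pi>\<^sub>M k\<in>?K. borel) (X g)) (\<Pi>\<^sub>E k\<in>?K. UNIV) \<noteq> \<infinity>" for i :: nat
      by simp
  qed (use I in \<open>auto simp: space_PiM\<close>)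
  \<comment> \<open>\<open>\<Phi>\<close> reassembles vectors from the flattened family; pushing
    forward along it returns to the product of vector spaces.\<close>
  define \<Phi> where "\<Phi> y = (\<lambda>t\<in>I. \<chi> i. y (t, i))" for y :: "nat \<times> 'x \<Rightarrow> real"
  have \<Phi>m: "\<Phi> \<in> (\<Pi>\<^sub>M k\<in>?K. borel) \<rightarrow>\<^sub>M (\<Pi>\<^sub>M t\<in>I. borel)"
    unfolding \<Phi>_def by measurable
  have \<Phi>X: "\<Phi> \<circ> X h = (\<lambda>z. \<lambda>t\<in>I. h z t)" for h
    by (auto simp: \<Phi>_def X_def fun_eq_iff vec_eq_iff)
  show ?thesis
    using distr_distr[OF \<Phi>m XL] distr_distr[OF \<Phi>m XL'] distrX
    by (simp add: \<Phi>X)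
qed

subsection \<open>Densities on finite products\<close>

lemma product_sigma_finite_lborel: "product_sigma_finite (\<lambda>_. lborel :: 'b::euclidean_space measure)"
  by (simp add: product_sigma_finite_def lborel.sigma_finite_measure_axioms)

lemma sets_PiM_lborel: "sets (\<Pi>\<^sub>M t\<in>I. (lborel :: 'b::euclidean_space measure)) = sets (\<Pi>\<^sub>M t\<in>I. borel)"
  by (rule sets_PiM_cong) simp_all

lemma measurable_PiM_lborel_iff:
  "f \<in> (\<Pi>\<^sub>M t\<in>I. (lborel :: 'b::euclidean_space measure)) \<rightarrow>\<^sub>M N \<longleftrightarrow> f \<in> (\<Pi>\<^sub>M t\<in>I. borel) \<rightarrow>\<^sub>M N"
  by (simp only: measurable_cong_sets[OF sets_PiM_lborel refl])

lemma emeasure_PiM_open_box_pos: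
  fixes V :: "'i \<Rightarrow> 'b::euclidean_space set"
  assumes I: "finite I" and V: "\<And>i. i \<in> I \<Longrightarrow> open (V i)" "\<And>i. i \<in> I \<Longrightarrow> V i \<noteq> {}"
  shows "emeasure (\<Pi>\<^sub>M i\<in>I. lborel) (Pi\<^sub>E I V) \<noteq> 0"
proof -
  interpret product_sigma_finite "\<lambda>_. lborel :: 'b measure" by (rule product_sigma_finite_lborel)
  have "emeasure lborel (V i) \<noteq> 0" if "i \<in> I" for i
  proof
    assume "emeasure lborel (V i) = 0"
    then have "V i \<in> null_sets lborel" using V(1)[OF that] by (simp add: null_sets_def)
    then have "V i \<in> null_sets lebesgue" by (simp add: null_sets_completionI)
    then have "negligible (V i)" by (simp add: negligible_iff_null_sets)
    then show False using open_not_negligible V that by blast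
  qed
  then show ?thesis
    using I V(1) by (subst emeasure_PiM) auto
qed

text \<open>The set where the two functions differ is relatively open, so around \<open>z0\<close>
  it contains a product of open sets, which has positive measure.\<close>

lemma continuous_AE_eq_imp_eq:
  fixes F G :: "('i \<Rightarrow> 'b::euclidean_space) \<Rightarrow> real"
  assumes I: "finite I" and F: "continuous_on (I \<rightarrow>\<^sub>E UNIV) F" and G: "continuous_on (I \<rightarrow>\<^sub>E UNIV) G"
    and AE: "AE z in \<Pi>\<^sub>M i\<in>I. lborel. F z = G z" and z0: "z0 \<in> I \<rightarrow>\<^sub>E UNIV"
  shows "F z0 = G z0"
proof (rule ccontr)
  assume ne: "F z0 \<noteq> G z0"
  have "openin (top_of_set (I \<rightarrow>\<^sub>E UNIV)) ((I \<rightarrow>\<^sub>E UNIV) \<inter> (\<lambda>z. F z - G z) -` (- {0}))"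
    by (intro continuous_openin_preimage_gen continuous_on_diff F G) auto
  then obtain W where W: "open W" "(I \<rightarrow>\<^sub>E UNIV) \<inter> (\<lambda>z. F z - G z) -` (- {0}) = (I \<rightarrow>\<^sub>E UNIV) \<inter> W"
    by (auto simp: openin_open)
  have "z0 \<in> W" using W(2) ne z0 by auto
  moreover have "openin (product_topology (\<lambda>_. euclidean) UNIV) W"
    using W(1) by (simp add: open_fun_def)
  ultimately obtain X where X: "z0 \<in> (\<Pi>\<^sub>E i\<in>UNIV. X i)" "\<And>i. open (X i)" "(\<Pi>\<^sub>E i\<in>UNIV. X i) \<subseteq> W"
    using product_topology_open_contains_basis[of "\<lambda>_. euclidean" UNIV W z0] by auto
  have "Pi\<^sub>E I X \<subseteq> {z. F z \<noteq> G z}"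
  proof
    fix z assume z: "z \<in> Pi\<^sub>E I X"
    \<comment> \<open>\<open>X\<close> constrains every index, also those outside \<open>I\<close>;
      there all extensional functions coincide with \<open>z0\<close>, so the constraint is
      met.\<close>
    have "z i \<in> X i" for i
    proof (cases "i \<in> I")
      case False
      then have "z i = z0 i" using z z0 by (simp add: PiE_iff extensional_def)
      then show ?thesis using X(1) by auto
    qed (use z in auto)
    then have "z \<in> W" using X(3) by (auto simp: PiE_iff)
    moreover have "z \<in> I \<rightarrow>\<^sub>E UNIV" using z by auto
    ultimately have "z \<in> (I \<rightarrow>\<^sub>E UNIV) \<inter> (\<lambda>z. F z - G z) -` (- {0})" using W(2) by blast
    then show "z \<in> {z. F z \<noteq> G z}" by auto
  qed
  then have "AE z in \<Pi>\<^sub>M i\<in>I. lborel. z \<notin> Pi\<^sub>E I X"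
    using AE by (auto elim!: eventually_mono)
  moreover have "Pi\<^sub>E I X \<in> sets (\<Pi>\<^sub>M i\<in>I. (lborel :: 'b measure))"
    using I X(2) by (intro sets_PiM_I_finite) auto
  ultimately have "emeasure (\<Pi>\<^sub>M i\<in>I. lborel) (Pi\<^sub>E I X) = 0"
    by (metis AE_iff_null_sets null_setsD1)
  moreover have "X i \<noteq> {}" for i using X(1) by auto
  ultimately show False
    using emeasure_PiM_open_box_pos[of I X] I X(2) by blast
qed

text \<open>Tonelli, one factor at a time: the coordinate \<open>k\<close> is transformed for a
  fixed rest, and the induction hypothesis is applied to the resulting inner integral
  \<open>?H\<close> as a function of the rest.\<close>

lemma nn_integral_PiM_change_of_variables:
  fixes v :: "real^'n \<Rightarrow> real^'n"
  assumes v: "\<And>x. (v has_derivative v' x) (at x)" and "bij v"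
    and J: "(\<lambda>x. \<bar>det (matrix (v' x))\<bar>) \<in> borel_measurable borel"
    and "finite I" and "h \<in> borel_measurable (\<Pi>\<^sub>M i\<in>I. borel)"
  shows "(\<integral>\<^sup>+z. h z \<partial>(\<Pi>\<^sub>M i\<in>I. lborel)) =
    (\<integral>\<^sup>+z. h (\<lambda>i\<in>I. v (z i)) * (\<Prod>i\<in>I. ennreal \<bar>det (matrix (v' (z i)))\<bar>) \<partial>(\<Pi>\<^sub>M i\<in>I. lborel))"
  using \<open>finite I\<close> \<open>h \<in> _\<close>
proof (induction I arbitrary: h rule: finite_induct)
  case empty
  interpret product_sigma_finite "\<lambda>_. lborel :: (real^'n) measure" by (rule product_sigma_finite_lborel)
  show ?case by (simp add: PiM_empty nn_integral_count_space_finite restrict_def)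
next
  case (insert k I)
  interpret product_sigma_finite "\<lambda>_. lborel :: (real^'n) measure" by (rule product_sigma_finite_lborel)
  have "continuous_on UNIV v"
    using v by (meson continuous_at_imp_continuous_on has_derivative_continuous)
  then have [measurable]: "v \<in> borel_measurable borel"
    by (rule borel_measurable_continuous_onI)
  note [measurable] = J
  let ?J = "\<lambda>x. ennreal \<bar>det (matrix (v' x))\<bar>"
  have [measurable]: "h \<in> borel_measurable (\<Pi>\<^sub>M i\<in>insert k I. borel)" by fact
  have [measurable]: "?J \<in> borel_measurable borel" by measurable
  have upd: "(\<lambda>y. x(k := y)) \<in> borel \<rightarrow>\<^sub>M (\<Pi>\<^sub>M i\<in>insert k I. (borel :: (real^'n) measure))"
    if "x \<in> I \<rightarrow>\<^sub>E UNIV" for x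
    using measurable_fun_upd[of "insert k I" I k "\<lambda>_. x" borel "\<lambda>_. borel" "\<lambda>y. y"] that
    by (simp add: space_PiM)
  have inner: "(\<integral>\<^sup>+y. h (x(k := y)) \<partial>lborel) = (\<integral>\<^sup>+y. h (x(k := v y)) * ?J y \<partial>lborel)"
    if "x \<in> I \<rightarrow>\<^sub>E UNIV" for x
    using nn_integral_change_of_variables[OF v \<open>bij v\<close> J, of "\<lambda>y. h (x(k := y))"]
      measurable_compose[OF upd[OF that] \<open>h \<in> _\<close>] by simp
  let ?H = "\<lambda>x. \<integral>\<^sup>+y. h (x(k := v y)) * ?J y \<partial>lborel"
  have pair: "(\<lambda>(x, y). h (x(k := v y)) * ?J y) \<in> borel_measurable ((\<Pi>\<^sub>M i\<in>I. borel) \<Otimes>\<^sub>M lborel)"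
    by measurable
  have H: "?H \<in> borel_measurable (\<Pi>\<^sub>M i\<in>I. borel)"
    using lborel.borel_measurable_nn_integral[OF pair] by simp
  have "(\<integral>\<^sup>+z. h z \<partial>(\<Pi>\<^sub>M i\<in>insert k I. lborel)) = (\<integral>\<^sup>+x. \<integral>\<^sup>+y. h (x(k := y)) \<partial>lborel \<partial>(\<Pi>\<^sub>M i\<in>I. lborel))"
    using insert.hyps insert.prems by (subst product_nn_integral_insert) (simp_all add: measurable_PiM_lborel_iff)
  also have "\<dots> = (\<integral>\<^sup>+x. ?H x \<partial>(\<Pi>\<^sub>M i\<in>I. lborel))"
    by (intro nn_integral_cong inner) (simp add: space_PiM)
  also have "\<dots> = (\<integral>\<^sup>+x. ?H (\<lambda>i\<in>I. v (x i)) * (\<Prod>i\<in>I. ?J (x i)) \<partial>(\<Pi>\<^sub>M i\<in>I. lborel))"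
    by (rule insert.IH[OF H])
  also have "\<dots> = (\<integral>\<^sup>+x. \<integral>\<^sup>+y. h (\<lambda>i\<in>insert k I. v ((x(k := y)) i)) * (\<Prod>i\<in>insert k I. ?J ((x(k := y)) i)) \<partial>lborel
       \<partial>(\<Pi>\<^sub>M i\<in>I. lborel))"
  proof (rule nn_integral_cong)
    fix x :: "'a \<Rightarrow> real^'n"
    let ?x = "\<lambda>i\<in>I. v (x i)"
    have "?x \<in> I \<rightarrow>\<^sub>E UNIV" by simp
    then have m: "(\<lambda>y. h (?x(k := v y)) * ?J y) \<in> borel_measurable lborel"
      using measurable_compose[OF measurable_compose[OF \<open>v \<in> _\<close> upd] \<open>h \<in> _\<close>] by simp
    have eq: "(\<lambda>i\<in>insert k I. v ((x(k := y)) i)) = ?x(k := v y)" for y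
      by (auto simp: fun_eq_iff)
    have eq2: "(\<Prod>i\<in>insert k I. ?J ((x(k := y)) i)) = ?J y * (\<Prod>i\<in>I. ?J (x i))" for y
      using insert.hyps by (auto intro!: arg_cong2[where f = "(*)"] prod.cong)
    show "?H ?x * (\<Prod>i\<in>I. ?J (x i)) = (\<integral>\<^sup>+y. h (\<lambda>i\<in>insert k I. v ((x(k := y)) i)) * (\<Prod>i\<in>insert k I. ?J ((x(k := y)) i)) \<partial>lborel)"
      unfolding eq eq2 using m by (simp add: mult.assoc[symmetric] nn_integral_multc)
  qed
  also have "\<dots> = (\<integral>\<^sup>+z. h (\<lambda>i\<in>insert k I. v (z i)) * (\<Prod>i\<in>insert k I. ?J (z i)) \<partial>(\<Pi>\<^sub>M i\<in>insert k I. lborel))"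
  proof (rule product_nn_integral_insert[OF insert.hyps, symmetric])
    show "(\<lambda>z. h (\<lambda>i\<in>insert k I. v (z i)) * (\<Prod>i\<in>insert k I. ?J (z i))) \<in> borel_measurable (\<Pi>\<^sub>M i\<in>insert k I. lborel)"
      unfolding measurable_PiM_lborel_iff by measurable
  qed
  finally show ?case .
qed

text \<open>Pulling the law with density \<open>P\<close> back along coordinatewise \<open>v\<close>
  gives the density on the right-hand side; densities with respect to a sigma-finite measure are
  unique almost everywhere.\<close>

lemma density_eq_under_diffeomorphism:
  fixes v :: "real^'n \<Rightarrow> real^'n"
  assumes v: "\<And>x. (v has_derivative v' x) (at x)" and "bij v"
    and J: "(\<lambda>x. \<bar>det (matrix (v' x))\<bar>) \<in> borel_measurable borel"
    and inv_v: "inv v \<in> borel_measurable borel"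
    and I: "finite I" and P: "P \<in> borel_measurable (\<Pi>\<^sub>M i\<in>I. borel)"
    and P': "P' \<in> borel_measurable (\<Pi>\<^sub>M i\<in>I. borel)"
    and eq: "density (\<Pi>\<^sub>M i\<in>I. lborel) P =
      distr (density (\<Pi>\<^sub>M i\<in>I. lborel) P') (\<Pi>\<^sub>M i\<in>I. borel) (\<lambda>z. \<lambda>i\<in>I. v (z i))"
  shows "AE z in \<Pi>\<^sub>M i\<in>I. lborel. P' z = P (\<lambda>i\<in>I. v (z i)) * (\<Prod>i\<in>I. ennreal \<bar>det (matrix (v' (z i)))\<bar>)"
proof -
  let ?\<Lambda> = "\<Pi>\<^sub>M i\<in>I. (lborel :: (real^'n) measure)" and ?J = "\<lambda>x. ennreal \<bar>det (matrix (v' x))\<bar>"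
  interpret product_sigma_finite "\<lambda>_. lborel :: (real^'n) measure" by (rule product_sigma_finite_lborel)
  interpret \<Lambda>: sigma_finite_measure ?\<Lambda> by (rule sigma_finite[OF I])
  have "continuous_on UNIV v"
    using v by (meson continuous_at_imp_continuous_on has_derivative_continuous)
  then have [measurable]: "v \<in> borel_measurable borel"
    by (rule borel_measurable_continuous_onI)
  note [measurable] = J inv_v P P'
  have V: "(\<lambda>z. \<lambda>i\<in>I. v (z i)) \<in> (\<Pi>\<^sub>M i\<in>I. borel) \<rightarrow>\<^sub>M (\<Pi>\<^sub>M i\<in>I. borel)"
    and V': "(\<lambda>z. \<lambda>i\<in>I. inv v (z i)) \<in> (\<Pi>\<^sub>M i\<in>I. borel) \<rightarrow>\<^sub>M (\<Pi>\<^sub>M i\<in>I. borel)"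
    by measurable
  let ?Q = "\<lambda>z. P (\<lambda>i\<in>I. v (z i)) * (\<Prod>i\<in>I. ?J (z i))"
  have Q: "?Q \<in> borel_measurable (\<Pi>\<^sub>M i\<in>I. borel)"
    by measurable
  have "density ?\<Lambda> P' = density ?\<Lambda> ?Q"
  proof (rule measure_eqI)
    fix E assume "E \<in> sets (density ?\<Lambda> P')"
    then have E[measurable]: "E \<in> sets (\<Pi>\<^sub>M i\<in>I. borel)" by (simp add: sets_PiM_lborel)
    let ?V = "\<lambda>z. \<lambda>i\<in>I. v (z i)" and ?V' = "\<lambda>z. \<lambda>i\<in>I. inv v (z i)"
    have VV: "?V' (?V z) = z" if "z \<in> I \<rightarrow>\<^sub>E UNIV" for z
      using that \<open>bij v\<close> by (auto simp: fun_eq_iff PiE_iff extensional_def bij_is_inj)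
    have hm: "(\<lambda>y. indicator E (?V' y) :: ennreal) \<in> borel_measurable (\<Pi>\<^sub>M i\<in>I. borel)"
      by (rule measurable_compose[OF V']) simp
    have "emeasure (density ?\<Lambda> P') E = (\<integral>\<^sup>+z. indicator E z \<partial>density ?\<Lambda> P')"
      using E by (simp add: sets_PiM_lborel)
    \<comment> \<open>Inserting the identity \<open>?V' (?V z) = z\<close> makes the integrand a
      function of \<open>?V z\<close>, so that the hypothesis on push-forwards can be used.\<close>
    also have "\<dots> = (\<integral>\<^sup>+z. indicator E (?V' (?V z)) \<partial>density ?\<Lambda> P')"
      by (intro nn_integral_cong) (simp only: VV space_PiM space_density space_lborel space_borel)
    also have "\<dots> = (\<integral>\<^sup>+y. indicator E (?V' y) \<partial>distr (density ?\<Lambda> P') (\<Pi>\<^sub>M i\<in>I. borel) ?V)"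
      using V hm by (subst nn_integral_distr) (simp_all add: measurable_PiM_lborel_iff)
    also have "\<dots> = (\<integral>\<^sup>+y. indicator E (?V' y) \<partial>density ?\<Lambda> P)"
      unfolding eq ..
    also have "\<dots> = (\<integral>\<^sup>+y. P y * indicator E (?V' y) \<partial>?\<Lambda>)"
      using P hm by (subst nn_integral_density) (simp_all add: measurable_PiM_lborel_iff)
    also have "\<dots> = (\<integral>\<^sup>+z. P (?V z) * indicator E (?V' (?V z)) * (\<Prod>i\<in>I. ?J (z i)) \<partial>?\<Lambda>)"
      using P hm by (intro nn_integral_PiM_change_of_variables[OF v \<open>bij v\<close> J I, of "\<lambda>y. P y * indicator E (?V' y)"]) auto
    also have "\<dots> = (\<integral>\<^sup>+z. ?Q z * indicator E z \<partial>?\<Lambda>)"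
      by (intro nn_integral_cong) (simp only: VV space_PiM space_lborel space_borel mult_ac)
    also have "\<dots> = emeasure (density ?\<Lambda> ?Q) E"
      using Q E by (subst emeasure_density) (simp_all add: measurable_PiM_lborel_iff sets_PiM_lborel)
    finally show "emeasure (density ?\<Lambda> P') E = emeasure (density ?\<Lambda> ?Q) E" .
  qed simp
  then show ?thesis
    using Q P' by (subst \<Lambda>.density_unique_iff[symmetric]) (simp_all add: measurable_PiM_lborel_iff)
qed

text \<open>If \<open>m'\<close> leaves the closed set \<open>range m\<close>, it does so on a
  nonempty open set. Paths staying in that set have positive probability under the positive density
  \<open>P'\<close>, while the law produced by \<open>m\<close> gives their images mass
  zero.\<close>

lemma closed_range_subset_of_law_eq:
  fixes m m' :: "'b::euclidean_space \<Rightarrow> 'c::euclidean_space"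
  assumes I: "finite I" "I \<noteq> {}" and m: "continuous_on UNIV m" and m': "continuous_on UNIV m'"
    and "closed (range m)"
    and P': "P' \<in> borel_measurable (\<Pi>\<^sub>M i\<in>I. borel)" "\<And>z. z \<in> I \<rightarrow>\<^sub>E UNIV \<Longrightarrow> P' z > 0"
    and eq: "distr (density (\<Pi>\<^sub>M i\<in>I. lborel) P) (\<Pi>\<^sub>M i\<in>I. borel) (\<lambda>z. \<lambda>i\<in>I. m (z i)) =
      distr (density (\<Pi>\<^sub>M i\<in>I. lborel) P') (\<Pi>\<^sub>M i\<in>I. borel) (\<lambda>z. \<lambda>i\<in>I. m' (z i))"
  shows "range m' \<subseteq> range m"
proof (rule ccontr)
  assume "\<not> range m' \<subseteq> range m"
  then obtain z0 where z0: "m' z0 \<notin> range m" by auto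
  let ?U = "- range m"
  let ?A = "Pi\<^sub>E I (\<lambda>_. ?U)"
  have [measurable]: "m \<in> borel_measurable borel" "m' \<in> borel_measurable borel"
    using m m' by (auto intro: borel_measurable_continuous_onI)
  have A: "?A \<in> sets (\<Pi>\<^sub>M i\<in>I. borel)"
    using I \<open>closed (range m)\<close> by (intro sets_PiM_I_finite) (auto intro: borel_closed)
  have mm: "(\<lambda>z. \<lambda>i\<in>I. m (z i)) \<in> (\<Pi>\<^sub>M i\<in>I. borel) \<rightarrow>\<^sub>M (\<Pi>\<^sub>M i\<in>I. borel)"
    "(\<lambda>z. \<lambda>i\<in>I. m' (z i)) \<in> (\<Pi>\<^sub>M i\<in>I. borel) \<rightarrow>\<^sub>M (\<Pi>\<^sub>M i\<in>I. borel)"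
    by measurable
  \<comment> \<open>Here \<open>I \<noteq> {}\<close> matters: over the empty index set
    \<open>?A\<close> would contain the empty path.\<close>
  have empty: "(\<lambda>z. \<lambda>i\<in>I. m (z i)) -` ?A = {}"
    using I(2) by (auto simp: PiE_iff)
  have "emeasure (distr (density (\<Pi>\<^sub>M i\<in>I. lborel) P) (\<Pi>\<^sub>M i\<in>I. borel) (\<lambda>z. \<lambda>i\<in>I. m (z i))) ?A = emeasure (density (\<Pi>\<^sub>M i\<in>I. lborel) P) {}"
    using mm A empty by (subst emeasure_distr) (simp_all add: measurable_PiM_lborel_iff)
  then have 0: "emeasure (distr (density (\<Pi>\<^sub>M i\<in>I. lborel) P') (\<Pi>\<^sub>M i\<in>I. borel) (\<lambda>z. \<lambda>i\<in>I. m' (z i))) ?A = 0"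
    by (simp add: eq)
  let ?V = "m' -` ?U"
  have V: "open ?V"
    using \<open>closed (range m)\<close> m' by (auto intro: open_vimage)
  have VI: "Pi\<^sub>E I (\<lambda>_. ?V) \<in> sets (\<Pi>\<^sub>M i\<in>I. borel)"
    using I V by (intro sets_PiM_I_finite) auto
  have pre: "(\<lambda>z. \<lambda>i\<in>I. m' (z i)) -` ?A \<inter> space (\<Pi>\<^sub>M i\<in>I. borel) = Pi\<^sub>E I (\<lambda>_. ?V)"
    by (auto simp: PiE_iff space_PiM)
  have "space (\<Pi>\<^sub>M i\<in>I. (lborel::'b measure)) = space (\<Pi>\<^sub>M i\<in>I. borel)" by (simp add: space_PiM)
  then have "emeasure (density (\<Pi>\<^sub>M i\<in>I. lborel) P') (Pi\<^sub>E I (\<lambda>_. ?V)) = 0"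
    using 0 mm A pre by (subst (asm) emeasure_distr) (simp_all add: measurable_PiM_lborel_iff)
  then have "(\<integral>\<^sup>+z. P' z * indicator (Pi\<^sub>E I (\<lambda>_. ?V)) z \<partial>(\<Pi>\<^sub>M i\<in>I. lborel)) = 0"
    using P' VI by (subst (asm) emeasure_density) (simp_all add: measurable_PiM_lborel_iff sets_PiM_lborel)
  then have "AE z in \<Pi>\<^sub>M i\<in>I. lborel. P' z * indicator (Pi\<^sub>E I (\<lambda>_. ?V)) z = 0"
    using P' VI by (subst (asm) nn_integral_0_iff_AE) (simp_all add: measurable_PiM_lborel_iff sets_PiM_lborel)
  then have "AE z in \<Pi>\<^sub>M i\<in>I. lborel. z \<notin> Pi\<^sub>E I (\<lambda>_. ?V)"
  proof (rule AE_mp, intro AE_I2 impI)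
    fix z assume "z \<in> space (\<Pi>\<^sub>M i\<in>I. (lborel :: 'b measure))"
      and "P' z * indicator (Pi\<^sub>E I (\<lambda>_. ?V)) z = 0"
    then show "z \<notin> Pi\<^sub>E I (\<lambda>_. ?V)"
      using P'(2)[of z] by (auto simp: space_PiM indicator_def split: if_splits)
  qed
  then have "emeasure (\<Pi>\<^sub>M i\<in>I. lborel) (Pi\<^sub>E I (\<lambda>_. ?V)) = 0"
    using VI by (metis AE_iff_null_sets null_setsD1 sets_PiM_lborel)
  then show False
    using emeasure_PiM_open_box_pos[of I "\<lambda>_. ?V"] V I z0 by auto
qed

subsection \<open>The law of the latent path\<close>

lemma nn_integral_lborel_cart_prod:
  fixes f :: "'n::finite \<Rightarrow> real \<Rightarrow> ennreal"
  assumes "\<And>i. f i \<in> borel_measurable borel"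
  shows "(\<integral>\<^sup>+x. (\<Prod>i\<in>UNIV. f i (x $ i)) \<partial>(lborel :: (real^'n) measure)) = (\<Prod>i\<in>UNIV. \<integral>\<^sup>+s. f i s \<partial>lborel)"
proof -
  let ?e = "\<lambda>i::'n. axis i (1::real)"
  have inj: "inj ?e" by (auto simp: inj_on_def axis_eq_axis)
  have B: "Basis = range ?e" by (auto simp: Basis_vec_def)
  have reidx: "(\<Prod>b\<in>Basis. F b) = (\<Prod>i\<in>UNIV. F (?e i))" for F :: "real^'n \<Rightarrow> ennreal"
    unfolding B by (subst prod.reindex[OF inj]) simp
  show ?thesis
    using nn_integral_lborel_prod[of "\<lambda>b. f (inv ?e b)"] assms
    by (simp add: reidx inv_f_f[OF inj] inner_axis)
qed

text \<open>Reading each transition density off one whole path makes all of them functions of the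
  same argument; the restrictions produce the extensional histories on which the factors are
  specified.\<close>

definition path_density ::
    "('x::finite, 'z::finite, 'a::finite) latent_model \<Rightarrow> (nat \<Rightarrow> real^'a) \<Rightarrow> nat \<Rightarrow> (nat \<Rightarrow> real^'z) \<Rightarrow> real" where
  "path_density \<theta> ah t z = trans_density \<theta> t (z t) (restrict z {1..<t}) (restrict ah {0..<t})"

lemma latent_law_path_density:
  "latent_law T \<theta> ah = density (\<Pi>\<^sub>M t\<in>{1..T}. lborel) (\<lambda>z. ennreal (\<Prod>t\<in>{1..T}. path_density \<theta> ah t z))"
  by (simp add: latent_law_def path_density_def)

lemma restrict_a_hists: "ah \<in> a_hists \<A> T \<Longrightarrow> t \<le> T \<Longrightarrow> restrict ah {0..<t} \<in> a_hists \<A> t"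
  by auto

section \<open>Positivity, measurability and total mass of the densities of one model\<close>

context
  fixes T :: nat and \<A> :: "(real^'a) set" and \<theta> :: "('x::finite, 'z::finite, 'a::finite) latent_model"
  assumes model: "graphical_latent_model T \<A> \<theta>"
begin

lemma factor_pos: "t \<in> {1..T} \<Longrightarrow> ah \<in> a_hists \<A> t \<Longrightarrow> zh \<in> z_hists t \<Longrightarrow> 0 < factor \<theta> t i s zh ah"
  using model unfolding graphical_latent_model_def by blast

lemma nn_integral_factor:
  "t \<in> {1..T} \<Longrightarrow> ah \<in> a_hists \<A> t \<Longrightarrow> zh \<in> z_hists t \<Longrightarrow> (\<integral>\<^sup>+ s. ennreal (factor \<theta> t i s zh ah) \<partial>lborel) = 1"
  using model unfolding graphical_latent_model_def by blast

lemma factor_measurable: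
  "t \<in> {1..T} \<Longrightarrow> ah \<in> a_hists \<A> t \<Longrightarrow>
    (\<lambda>(s, zh). factor \<theta> t i s zh ah) \<in> borel_measurable (borel \<Otimes>\<^sub>M (\<Pi>\<^sub>M s\<in>{1..<t}. borel))"
  using model unfolding graphical_latent_model_def by blast

lemma trans_density_pos:
  "t \<in> {1..T} \<Longrightarrow> ah \<in> a_hists \<A> t \<Longrightarrow> zh \<in> z_hists t \<Longrightarrow> 0 < trans_density \<theta> t z zh ah"
  unfolding trans_density_def by (intro prod_pos) (simp add: factor_pos)

lemma factor_section_measurable:
  assumes "t \<in> {1..T}" "ah \<in> a_hists \<A> t" "zh \<in> z_hists t"
  shows "(\<lambda>s. factor \<theta> t i s zh ah) \<in> borel_measurable borel"
proof -
  have "(\<lambda>s. (s, zh)) \<in> borel \<rightarrow>\<^sub>M borel \<Otimes>\<^sub>M (\<Pi>\<^sub>M s\<in>{1..<t}. borel)"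
  proof (intro measurable_Pair measurable_const)
    show "zh \<in> space (\<Pi>\<^sub>M s\<in>{1..<t}. borel)"
      using assms(3) by (simp only: space_PiM space_borel)
  qed simp
  from measurable_compose[OF this factor_measurable[OF assms(1,2)]] show ?thesis by simp
qed

lemma nn_integral_trans_density:
  assumes "t \<in> {1..T}" "ah \<in> a_hists \<A> t" "zh \<in> z_hists t"
  shows "(\<integral>\<^sup>+z. ennreal (trans_density \<theta> t z zh ah) \<partial>lborel) = 1"
proof -
  have "(\<integral>\<^sup>+z. ennreal (trans_density \<theta> t z zh ah) \<partial>lborel) =
      (\<integral>\<^sup>+z. (\<Prod>i\<in>UNIV. ennreal (factor \<theta> t i (z $ i) zh ah)) \<partial>(lborel :: (real^'z) measure))"
    unfolding trans_density_def
    by (intro nn_integral_cong, subst prod_ennreal) (simp_all add: less_imp_le[OF factor_pos[OF assms]])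
  also have "\<dots> = (\<Prod>i\<in>UNIV. \<integral>\<^sup>+s. ennreal (factor \<theta> t i s zh ah) \<partial>lborel)"
    by (rule nn_integral_lborel_cart_prod) (use factor_section_measurable[OF assms] in measurable)
  also have "\<dots> = 1" by (simp only: nn_integral_factor[OF assms] prod.neutral_const)
  finally show ?thesis .
qed

lemma path_density_pos:
  "ah \<in> a_hists \<A> T \<Longrightarrow> t \<in> {1..T} \<Longrightarrow> 0 < path_density \<theta> ah t z"
  unfolding path_density_def by (rule trans_density_pos) (auto simp: restrict_a_hists)

lemma path_density_measurable:
  assumes "ah \<in> a_hists \<A> T" "t \<in> {1..T}" "{1..t} \<subseteq> I"
  shows "path_density \<theta> ah t \<in> borel_measurable (\<Pi>\<^sub>M s\<in>I. borel)"
proof -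
  have "t \<in> I" "{1..<t} \<subseteq> I" using assms by auto
  have "(\<lambda>z. factor \<theta> t i (z t $ i) (restrict z {1..<t}) (restrict ah {0..<t})) \<in> borel_measurable (\<Pi>\<^sub>M s\<in>I. borel)" for i
  proof -
    have "(\<lambda>z. (z t $ i, restrict z {1..<t})) \<in> (\<Pi>\<^sub>M s\<in>I. (borel :: (real^'z) measure)) \<rightarrow>\<^sub>M borel \<Otimes>\<^sub>M (\<Pi>\<^sub>M s\<in>{1..<t}. borel)"
      using \<open>t \<in> I\<close> \<open>{1..<t} \<subseteq> I\<close>
      by (intro measurable_Pair borel_measurable_vec_nth measurable_component_singleton measurable_restrict_subset)
    from measurable_compose[OF this factor_measurable[OF assms(2) restrict_a_hists[OF assms(1)]]] assms(2)
    show ?thesis by simp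
  qed
  then show ?thesis
    unfolding path_density_def[abs_def] trans_density_def by (intro borel_measurable_prod)
qed

lemma path_density_upd:
  "s \<le> n \<Longrightarrow> path_density \<theta> ah s (z(Suc n := y)) = path_density \<theta> ah s z"
proof -
  assume "s \<le> n"
  then have "restrict (z(Suc n := y)) {1..<s} = restrict z {1..<s}" by (auto simp: restrict_def fun_eq_iff)
  with \<open>s \<le> n\<close> show ?thesis by (simp add: path_density_def)
qed

lemma path_density_upd_last:
  "path_density \<theta> ah (Suc n) (z(Suc n := y)) =
    trans_density \<theta> (Suc n) y (restrict z {1..<Suc n}) (restrict ah {0..<Suc n})"
proof -
  have "restrict (z(Suc n := y)) {1..<Suc n} = restrict z {1..<Suc n}" by (auto simp: restrict_def fun_eq_iff)
  then show ?thesis by (simp add: path_density_def)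
qed

text \<open>Only the last transition density involves the last latent vector, and it integrates to
  one. Both the normalisation of \<open>latent_law\<close> and the descent in time rest on
  this.\<close>

lemma nn_integral_path_density_last:
  assumes "ah \<in> a_hists \<A> T" "Suc n \<le> T"
  shows "(\<integral>\<^sup>+y. ennreal (\<Prod>t\<in>{1..Suc n}. path_density \<theta> ah t (z(Suc n := y))) \<partial>lborel) =
    ennreal (\<Prod>t\<in>{1..n}. path_density \<theta> ah t z)"
proof -
  let ?a = "restrict ah {0..<Suc n}" and ?z = "restrict z {1..<Suc n}"
  have a: "?a \<in> a_hists \<A> (Suc n)" using assms by (intro restrict_a_hists)
  have pos: "0 \<le> (\<Prod>t\<in>{1..n}. path_density \<theta> ah t z)"
    using assms by (intro prod_nonneg ballI less_imp_le path_density_pos) auto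
  have split: "(\<Prod>t\<in>{1..Suc n}. path_density \<theta> ah t (z(Suc n := y))) =
      (\<Prod>t\<in>{1..n}. path_density \<theta> ah t z) * trans_density \<theta> (Suc n) y ?z ?a" for y
  proof -
    have "(\<Prod>t\<in>{1..n}. path_density \<theta> ah t (z(Suc n := y))) = (\<Prod>t\<in>{1..n}. path_density \<theta> ah t z)"
      by (rule prod.cong) (simp_all add: path_density_upd)
    then show ?thesis by (simp add: path_density_upd_last)
  qed
  have m: "(\<lambda>y. ennreal (trans_density \<theta> (Suc n) y ?z ?a)) \<in> borel_measurable lborel"
    unfolding trans_density_def using assms factor_section_measurable[OF _ a, of ?z]
    by (intro measurable_compose[OF _ measurable_ennreal] borel_measurable_prod
        measurable_compose[OF borel_measurable_vec_nth[OF measurable_ident]]) (auto simp: o_def)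
  show ?thesis
    unfolding split using assms m pos nn_integral_trans_density[OF _ a, of ?z]
    by (simp add: ennreal_mult' nn_integral_cmult)
qed

lemma nn_integral_path:
  assumes "ah \<in> a_hists \<A> T" "n \<le> T"
  shows "(\<integral>\<^sup>+z. ennreal (\<Prod>t\<in>{1..n}. path_density \<theta> ah t z) \<partial>(\<Pi>\<^sub>M t\<in>{1..n}. lborel)) = 1"
  using assms(2)
proof (induction n)
  case 0
  show ?case by (simp add: PiM_empty nn_integral_count_space_finite)
next
  case (Suc n)
  interpret product_sigma_finite "\<lambda>_. lborel :: (real^'z) measure" by (rule product_sigma_finite_lborel)
  have ins: "{1..Suc n} = insert (Suc n) {1..n}" by auto
  have m: "(\<lambda>z. ennreal (\<Prod>t\<in>{1..Suc n}. path_density \<theta> ah t z)) \<in> borel_measurable (\<Pi>\<^sub>M t\<in>insert (Suc n) {1..n}. lborel)"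
    unfolding measurable_PiM_lborel_iff using Suc.prems assms(1)
    by (intro measurable_compose[OF _ measurable_ennreal] borel_measurable_prod path_density_measurable) auto
  have "(\<integral>\<^sup>+z. ennreal (\<Prod>t\<in>{1..Suc n}. path_density \<theta> ah t z) \<partial>(\<Pi>\<^sub>M t\<in>insert (Suc n) {1..n}. lborel)) =
     (\<integral>\<^sup>+z. \<integral>\<^sup>+y. ennreal (\<Prod>t\<in>{1..Suc n}. path_density \<theta> ah t (z(Suc n := y))) \<partial>lborel \<partial>(\<Pi>\<^sub>M t\<in>{1..n}. lborel))"
    by (rule product_nn_integral_insert[OF _ _ m]) auto
  also have "\<dots> = 1"
    using Suc assms(1) by (simp only: nn_integral_path_density_last)
  finally show ?case unfolding ins .
qed

lemma prob_space_latent_law: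
  assumes "ah \<in> a_hists \<A> T"
  shows "prob_space (latent_law T \<theta> ah)"
proof
  have m: "(\<lambda>z. ennreal (\<Prod>t\<in>{1..T}. path_density \<theta> ah t z)) \<in> borel_measurable (\<Pi>\<^sub>M t\<in>{1..T}. lborel)"
    unfolding measurable_PiM_lborel_iff using assms
    by (intro measurable_compose[OF _ measurable_ennreal] borel_measurable_prod path_density_measurable) auto
  have "emeasure (latent_law T \<theta> ah) (space (latent_law T \<theta> ah)) =
     (\<integral>\<^sup>+z. ennreal (\<Prod>t\<in>{1..T}. path_density \<theta> ah t z) \<partial>(\<Pi>\<^sub>M t\<in>{1..T}. lborel))"
    unfolding latent_law_path_density using m by (subst emeasure_density) (auto intro!: nn_integral_cong)
  also have "\<dots> = 1" using assms by (rule nn_integral_path) simp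
  finally show "emeasure (latent_law T \<theta> ah) (space (latent_law T \<theta> ah)) = 1" .
qed

end

subsection \<open>Observational equivalence implies equivalence up to diffeomorphism\<close>

lemma C1_on_continuous_on: "C1_on S f \<Longrightarrow> continuous_on S f"
proof -
  assume "C1_on S f"
  then obtain U g g' where g: "open U" "S \<subseteq> U" "\<And>x. x \<in> S \<Longrightarrow> g x = f x"
      "\<And>x. x \<in> U \<Longrightarrow> (g has_derivative blinfun_apply (g' x)) (at x)"
    unfolding C1_on_def by blast
  then have "continuous_on S g"
    by (intro continuous_at_imp_continuous_on) (auto intro: has_derivative_continuous)
  then show ?thesis using g(3) by (simp cong: continuous_on_cong)
qed

lemma C1_on_UNIV_E:
  assumes "C1_on UNIV f"
  obtains f' where "\<And>x. (f has_derivative blinfun_apply (f' x)) (at x)" "continuous_on UNIV f'"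
proof -
  from assms obtain U g f' where g: "UNIV \<subseteq> U" "\<forall>x. g x = f x"
      "\<And>x. x \<in> U \<Longrightarrow> (g has_derivative blinfun_apply (f' x)) (at x)" "continuous_on U f'"
    unfolding C1_on_def by blast
  then have "U = UNIV" "g = f" by auto
  with g that show ?thesis by blast
qed

text \<open>The outer map, typically the inverse of a mixing function on its image, is C1 only
  through an extension \<open>h\<close> to an open set. As \<open>f\<close> stays inside
  \<open>S\<close>, the extension does not change the composition, which is thus differentiable in
  the ordinary sense.\<close>

lemma C1_on_comp:
  assumes g: "C1_on S g" and f: "C1_on UNIV f" and sub: "range f \<subseteq> S"
  shows "C1_on UNIV (g \<circ> f)"
proof -
  obtain U h h' where h: "open U" "S \<subseteq> U" "\<And>x. x \<in> S \<Longrightarrow> h x = g x"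
      "\<And>x. x \<in> U \<Longrightarrow> (h has_derivative blinfun_apply (h' x)) (at x)" "continuous_on U h'"
    using g unfolding C1_on_def by blast
  obtain f' where f': "\<And>x. (f has_derivative blinfun_apply (f' x)) (at x)" "continuous_on UNIV f'"
    using C1_on_UNIV_E[OF f] by metis
  have fU: "f x \<in> U" for x using sub h(2) by blast
  have cf: "continuous_on UNIV f" by (rule C1_on_continuous_on[OF f])
  have 1: "((h \<circ> f) has_derivative blinfun_apply (h' (f x) o\<^sub>L f' x)) (at x)" for x
    using diff_chain_at[OF f'(1) h(4)[OF fU], of x] by (simp add: o_def blinfun_compose.rep_eq)
  have "continuous_on UNIV (\<lambda>x. h' (f x))"
    using fU by (intro continuous_on_compose2[OF h(5) cf]) auto
  then have 2: "continuous_on UNIV (\<lambda>x. h' (f x) o\<^sub>L f' x)"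
    using f'(2) by (rule bounded_bilinear.continuous_on[OF bounded_bilinear_blinfun_compose])
  have 3: "(h \<circ> f) x = (g \<circ> f) x" for x using h(3) sub by auto
  show ?thesis
    unfolding C1_on_def using 1 2 3
    by (intro exI[of _ UNIV] exI[of _ "h \<circ> f"] conjI exI[of _ "\<lambda>x. h' (f x) o\<^sub>L f' x"]) auto
qed

text \<open>The inverse is \<open>inv m' \<circ> m\<close>, the same construction with the roles
  exchanged, so smoothness in both directions comes from \<open>C1_on_comp\<close>.\<close>

lemma diffeomorphism_on_comp_inv:
  assumes m: "diffeomorphism_on UNIV (range m) m" and m': "diffeomorphism_on UNIV (range m') m'"
    and range: "range m' = range m"
  shows "diffeomorphism_on UNIV UNIV (inv m \<circ> m')"
proof -
  have inj: "inj m" "inj m'" and C: "C1_on UNIV m" "C1_on UNIV m'"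
    and Ci: "C1_on (range m) (inv m)" "C1_on (range m) (inv m')"
    using m m' range by (auto simp: diffeomorphism_on_def bij_betw_def)
  have l: "(inv m' \<circ> m) ((inv m \<circ> m') x) = x" "(inv m \<circ> m') ((inv m' \<circ> m) y) = y" for x y
    using range inj by (simp_all add: f_inv_into_f[of _ m UNIV] f_inv_into_f[of _ m' UNIV])
       (metis f_inv_into_f inv_f_f rangeI)+
  have bij: "bij (inv m \<circ> m')"
    by (rule bij_betw_byWitness[where f' = "inv m' \<circ> m"]) (use l in auto)
  have "inv (inv m \<circ> m') = inv m' \<circ> m"
    by (rule inv_equality) (use l in auto)
  then show ?thesis
    using C1_on_comp[OF Ci(1) C(2)] C1_on_comp[OF Ci(2) C(1)] range bij
    by (simp add: diffeomorphism_on_def)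
qed

lemma continuous_on_det_derivative:
  fixes f' :: "'c::topological_space \<Rightarrow> (real^'n) \<Rightarrow>\<^sub>L (real^'n)"
  assumes "continuous_on S f'"
  shows "continuous_on S (\<lambda>x. \<bar>det (matrix (blinfun_apply (f' x)))\<bar>)"
  unfolding det_def matrix_def
  by (auto intro!: continuous_intros assms)

section \<open>Continuity of the densities in the latent variables\<close>

lemma C2_factors_continuous:
  assumes "C2_factors T \<A> \<theta>" "t \<in> {1..T}" "ah \<in> a_hists \<A> t"
  shows "continuous_on (insert None (Some ` ({1..<t} \<times> UNIV)) \<rightarrow>\<^sub>E UNIV)
    (\<lambda>y. factor \<theta> t i (y None) (\<lambda>r\<in>{1..<t}. \<chi> j. y (Some (r, j))) ah)"
proof -
  have "Ck_coord (Suc (Suc 0)) (insert None (Some ` ({1..<t} \<times> UNIV)))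
    (\<lambda>y. factor \<theta> t i (y None) (\<lambda>r\<in>{1..<t}. \<chi> j. y (Some (r, j))) ah)"
    using assms unfolding C2_factors_def numeral_2_eq_2 by blast
  then show ?thesis by (simp only: Ck_coord.simps)
qed

lemma path_density_continuous:
  fixes \<theta> :: "('x::finite, 'z::finite, 'a::finite) latent_model" and h :: "'c::topological_space \<Rightarrow> nat \<Rightarrow> real^'z"
  assumes C2: "C2_factors T \<A> \<theta>" and t: "t \<in> {1..T}" and ah: "ah \<in> a_hists \<A> T"
    and h: "\<And>s. s \<in> {1..t} \<Longrightarrow> continuous_on S (\<lambda>z. h z s)"
  shows "continuous_on S (\<lambda>z. path_density \<theta> ah t (h z))"
proof -
  let ?I = "insert None (Some ` ({1..<t} \<times> (UNIV::'z set)))" and ?a = "restrict ah {0..<t}"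
  have "continuous_on S (\<lambda>z. factor \<theta> t i (h z t $ i) (restrict (h z) {1..<t}) ?a)" for i
  proof -
    \<comment> \<open>The flattened argument of the smoothness assumption. The value
      \<open>undefined\<close> off the index set keeps \<open>Y z\<close> extensional, and
      continuity of \<open>Y\<close> is checked coordinatewise.\<close>
    define Y where "Y z = (\<lambda>k. case k of None \<Rightarrow> h z t $ i
      | Some (r, j) \<Rightarrow> if r \<in> {1..<t} then h z r $ j else undefined)" for z
    have YI: "Y z \<in> ?I \<rightarrow>\<^sub>E UNIV" for z
      by (auto simp: Y_def PiE_iff extensional_def split: option.splits)
    have "continuous_on S (\<lambda>z. Y z k)" for k
    proof (cases k)
      case None
      then show ?thesis using h[of t] t by (auto simp: Y_def intro!: continuous_intros)
    next
      case (Some p)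
      obtain r j where "p = (r, j)" by (cases p)
      then show ?thesis
        using h[of r] t Some by (cases "r \<in> {1..<t}") (auto simp: Y_def intro!: continuous_intros)
    qed
    then have "continuous_on S Y"
      by (intro continuous_on_coordinatewise_then_product)
    then have "continuous_on S (\<lambda>z. factor \<theta> t i (Y z None) (\<lambda>r\<in>{1..<t}. \<chi> j. Y z (Some (r, j))) ?a)"
      using YI t by (intro continuous_on_compose2[OF C2_factors_continuous[OF C2 t restrict_a_hists[OF ah]]]) auto
    moreover have "(\<lambda>r\<in>{1..<t}. \<chi> j. Y z (Some (r, j))) = restrict (h z) {1..<t}" "Y z None = h z t $ i" for z
      by (auto simp: Y_def fun_eq_iff vec_eq_iff)
    ultimately show ?thesis by simp
  qed
  then show ?thesis
    unfolding path_density_def trans_density_def by (intro continuous_on_prod)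
qed

lemma path_density_cong:
  assumes "t \<ge> 1" "\<And>s. s \<in> {1..t} \<Longrightarrow> z s = z' s"
  shows "path_density \<theta> ah t z = path_density \<theta> ah t z'"
proof -
  have "restrict z {1..<t} = restrict z' {1..<t}" "z t = z' t" using assms by (auto simp: restrict_def fun_eq_iff)
  then show ?thesis by (simp add: path_density_def)
qed

text \<open>Only laws of paths of length \<open>T\<close> are given. Single transition densities are
  recovered as quotients of the density identities for consecutive lengths.\<close>

lemma obs_equivalent_imp_diff_equivalent:
  fixes \<theta> \<theta>' :: "('x::finite, 'z::finite, 'a::finite) latent_model"
  assumes T: "1 \<le> T" and "\<A> \<noteq> {}"
    and model: "graphical_latent_model T \<A> \<theta>" and model': "graphical_latent_model T \<A> \<theta>'"
    and C2: "C2_factors T \<A> \<theta>" and C2': "C2_factors T \<A> \<theta>'"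
    and obs: "obs_equivalent T \<A> \<sigma>2 \<theta> \<theta>'"
  shows "diff_equivalent T \<A> \<theta> \<theta>' \<and> diffeomorphism_on UNIV UNIV (entanglement_map \<theta> \<theta>')"
proof -
  define m m' where "m = mixing \<theta>" and "m' = mixing \<theta>'"
  have dm: "diffeomorphism_on UNIV (range m) m" "closed (range m)"
    and dm': "diffeomorphism_on UNIV (range m') m'" "closed (range m')"
    using model model' unfolding graphical_latent_model_def m_def m'_def by blast+
  have inj: "inj m" "inj m'" and cm: "continuous_on UNIV m" "continuous_on UNIV m'"
    and ci: "continuous_on (range m) (inv m)"
    using dm dm' by (auto simp: diffeomorphism_on_def bij_betw_def intro: C1_on_continuous_on)
  then have [measurable]: "m \<in> borel_measurable borel" "m' \<in> borel_measurable borel"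
    by (auto intro: borel_measurable_continuous_onI)
  let ?\<Lambda> = "\<Pi>\<^sub>M t\<in>{1..T}. (lborel :: (real^'z) measure)"
  define P where "P \<phi> ah z = ennreal (\<Prod>t\<in>{1..T}. path_density \<phi> ah t z)"
    for \<phi> :: "('x, 'z, 'a) latent_model" and ah z
  have law: "latent_law T \<phi> ah = density ?\<Lambda> (P \<phi> ah)" for \<phi> ah
    unfolding P_def by (rule latent_law_path_density)
  have Pm: "P \<phi> ah \<in> borel_measurable (\<Pi>\<^sub>M t\<in>{1..T}. borel)"
    if "graphical_latent_model T \<A> \<phi>" "ah \<in> a_hists \<A> T" for \<phi> ah
    unfolding P_def[abs_def] using that
    by (intro measurable_compose[OF _ measurable_ennreal] borel_measurable_prod path_density_measurable) auto
  have Ppos: "0 < (\<Prod>t\<in>{1..n}. path_density \<phi> ah t z)"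
    if "graphical_latent_model T \<A> \<phi>" "ah \<in> a_hists \<A> T" "n \<le> T" for \<phi> :: "('x, 'z, 'a) latent_model" and ah z n
    using that(3) by (intro prod_pos path_density_pos[OF that(1,2)]) auto
  have laws: "distr (latent_law T \<theta> ah) (\<Pi>\<^sub>M t\<in>{1..T}. borel) (\<lambda>z. \<lambda>t\<in>{1..T}. m (z t)) =
      distr (latent_law T \<theta>' ah) (\<Pi>\<^sub>M t\<in>{1..T}. borel) (\<lambda>z. \<lambda>t\<in>{1..T}. m' (z t))"
    if ah: "ah \<in> a_hists \<A> T" for ah
  proof (rule gaussian_deconvolution)
    show "prob_space (latent_law T \<theta> ah)" "prob_space (latent_law T \<theta>' ah)"
      using prob_space_latent_law model model' ah by blast+
    show "(\<lambda>z. m (z t)) \<in> borel_measurable (latent_law T \<theta> ah)"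
      "(\<lambda>z. m' (z t)) \<in> borel_measurable (latent_law T \<theta>' ah)" if "t \<in> {1..T}" for t
      using that by (simp_all add: law measurable_PiM_lborel_iff)
    show "distr (latent_law T \<theta> ah \<Otimes>\<^sub>M Pi\<^sub>M {1..T} (\<lambda>t. gaussian_noise \<sigma>2)) (Pi\<^sub>M {1..T} (\<lambda>t. borel))
         (\<lambda>(z, n). \<lambda>t\<in>{1..T}. m (z t) + n t) =
        distr (latent_law T \<theta>' ah \<Otimes>\<^sub>M Pi\<^sub>M {1..T} (\<lambda>t. gaussian_noise \<sigma>2)) (Pi\<^sub>M {1..T} (\<lambda>t. borel))
         (\<lambda>(z, n). \<lambda>t\<in>{1..T}. m' (z t) + n t)"
      using obs ah unfolding obs_equivalent_def obs_law_def m_def m'_def by blast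
  qed simp
  \<comment> \<open>One constant history is enough to compare the two images; \<open>a0\<close> also
    pads shorter histories to length \<open>T\<close> at the end.\<close>
  obtain a0 where a0: "a0 \<in> \<A>" using \<open>\<A> \<noteq> {}\<close> by blast
  have ah0: "(\<lambda>t\<in>{0..<T}. a0) \<in> a_hists \<A> T" using a0 by auto
  have "range m' \<subseteq> range m"
    by (rule closed_range_subset_of_law_eq[OF _ _ cm dm(2) Pm[OF model' ah0] _ laws[OF ah0, unfolded law]])
       (use T Ppos[OF model' ah0] in \<open>auto simp: P_def\<close>)
  moreover have "range m \<subseteq> range m'"
    by (rule closed_range_subset_of_law_eq[OF _ _ cm(2,1) dm'(2) Pm[OF model ah0] _ laws[OF ah0, unfolded law, symmetric]])
       (use T Ppos[OF model ah0] in \<open>auto simp: P_def\<close>)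
  ultimately have range: "range m' = range m" by blast
  define v where "v = entanglement_map \<theta> \<theta>'"
  have v_def': "v = inv m \<circ> m'" by (simp add: v_def entanglement_map_def m_def m'_def)
  have dv: "diffeomorphism_on UNIV UNIV v"
    unfolding v_def' by (rule diffeomorphism_on_comp_inv[OF dm(1) dm'(1) range])
  then have "bij v" and Cv: "C1_on UNIV v" "C1_on UNIV (inv v)" by (auto simp: diffeomorphism_on_def)
  obtain v' where v': "\<And>x. (v has_derivative blinfun_apply (v' x)) (at x)" "continuous_on UNIV v'"
    using C1_on_UNIV_E[OF Cv(1)] by metis
  have cv: "continuous_on UNIV v" "continuous_on UNIV (inv v)" using Cv by (auto intro: C1_on_continuous_on)
  then have [measurable]: "v \<in> borel_measurable borel" and inv_v: "inv v \<in> borel_measurable borel"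
    by (auto intro: borel_measurable_continuous_onI)
  define J where "J x = \<bar>det (matrix (blinfun_apply (v' x)))\<bar>" for x
  have J0: "0 \<le> J x" for x by (simp add: J_def)
  have cJ: "continuous_on UNIV J" unfolding J_def[abs_def] by (rule continuous_on_det_derivative[OF v'(2)])
  have Jm: "(\<lambda>x. \<bar>det (matrix (blinfun_apply (v' x)))\<bar>) \<in> borel_measurable borel"
    using cJ unfolding J_def[abs_def] by (rule borel_measurable_continuous_onI)
  have latent: "latent_law T \<theta> ah = distr (latent_law T \<theta>' ah) (\<Pi>\<^sub>M t\<in>{1..T}. borel) (\<lambda>z. \<lambda>t\<in>{1..T}. v (z t))"
    if ah: "ah \<in> a_hists \<A> T" for ah
  proof -
    \<comment> \<open>\<open>inv m\<close> on the closed image and zero elsewhere: Borel on the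
      whole space, with \<open>m z\<close> sent to \<open>z\<close> and \<open>m' z\<close> to
      \<open>v z\<close>.\<close>
    define g where "g x = indicator (range m) x *\<^sub>R inv m x" for x
    have [measurable]: "g \<in> borel_measurable borel"
      unfolding g_def[abs_def] using dm(2) ci by (intro borel_measurable_continuous_on_indicator) auto
    let ?G = "\<lambda>x. \<lambda>t\<in>{1..T}. g (x t)"
    have Gm: "?G \<in> (\<Pi>\<^sub>M t\<in>{1..T}. borel) \<rightarrow>\<^sub>M (\<Pi>\<^sub>M t\<in>{1..T}. borel)" by measurable
    have Mm: "(\<lambda>z. \<lambda>t\<in>{1..T}. m (z t)) \<in> latent_law T \<theta> ah \<rightarrow>\<^sub>M (\<Pi>\<^sub>M t\<in>{1..T}. borel)"
      "(\<lambda>z. \<lambda>t\<in>{1..T}. m' (z t)) \<in> latent_law T \<theta>' ah \<rightarrow>\<^sub>M (\<Pi>\<^sub>M t\<in>{1..T}. borel)"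
      unfolding law measurable_density_eq1 measurable_PiM_lborel_iff by measurable
    have gm: "g (m z) = z" "g (m' z) = v z" for z
      using inj range by (auto simp: g_def v_def' indicator_def)
    have sp: "space (latent_law T \<theta> ah) = {1..T} \<rightarrow>\<^sub>E UNIV"
      by (simp only: law space_density space_PiM space_lborel space_borel)
    have "latent_law T \<theta> ah = distr (latent_law T \<theta> ah) (\<Pi>\<^sub>M t\<in>{1..T}. borel) (\<lambda>z. z)"
      by (rule distr_id2[symmetric]) (simp add: law sets_PiM_lborel)
    also have "\<dots> = distr (latent_law T \<theta> ah) (\<Pi>\<^sub>M t\<in>{1..T}. borel) (?G \<circ> (\<lambda>z. \<lambda>t\<in>{1..T}. m (z t)))"
      by (rule distr_cong) (auto simp: sp fun_eq_iff gm PiE_iff extensional_def)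
    also have "\<dots> = distr (latent_law T \<theta>' ah) (\<Pi>\<^sub>M t\<in>{1..T}. borel) (?G \<circ> (\<lambda>z. \<lambda>t\<in>{1..T}. m' (z t)))"
      using laws[OF ah] by (simp only: distr_distr[OF Gm Mm(1), symmetric] distr_distr[OF Gm Mm(2), symmetric])
    also have "?G \<circ> (\<lambda>z. \<lambda>t\<in>{1..T}. m' (z t)) = (\<lambda>z. \<lambda>t\<in>{1..T}. v (z t))"
      by (auto simp: fun_eq_iff gm)
    finally show ?thesis .
  qed
  have top: "(\<Prod>t\<in>{1..T}. path_density \<theta>' ah t z) =
      (\<Prod>t\<in>{1..T}. path_density \<theta> ah t (\<lambda>i\<in>{1..T}. v (z i))) * (\<Prod>t\<in>{1..T}. J (z t))"
    if ah: "ah \<in> a_hists \<A> T" and z: "z \<in> {1..T} \<rightarrow>\<^sub>E UNIV" for ah z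
  proof (rule continuous_AE_eq_imp_eq[OF _ _ _ _ z])
    have cz: "continuous_on S (\<lambda>z. z s)" for s and S :: "(nat \<Rightarrow> real^'z) set"
      by (rule continuous_on_subset[OF continuous_on_product_coordinates subset_UNIV])
    have cvz: "continuous_on S (\<lambda>z. v (z s))" "continuous_on S (\<lambda>z. J (z s))" for s and S :: "(nat \<Rightarrow> real^'z) set"
      by (rule continuous_on_compose2[OF cv(1) cz] continuous_on_compose2[OF cJ cz]; simp)+
    show "continuous_on ({1..T} \<rightarrow>\<^sub>E UNIV) (\<lambda>z. \<Prod>t\<in>{1..T}. path_density \<theta>' ah t z)"
      using ah by (intro continuous_on_prod path_density_continuous[OF C2'] cz) auto
    have "continuous_on ({1..T} \<rightarrow>\<^sub>E UNIV) (\<lambda>z. path_density \<theta> ah t (\<lambda>i\<in>{1..T}. v (z i)))" if "t \<in> {1..T}" for t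
      using ah that by (intro path_density_continuous[OF C2]) (auto intro!: cvz)
    then show "continuous_on ({1..T} \<rightarrow>\<^sub>E UNIV) (\<lambda>z. (\<Prod>t\<in>{1..T}. path_density \<theta> ah t (\<lambda>i\<in>{1..T}. v (z i))) * (\<Prod>t\<in>{1..T}. J (z t)))"
      by (intro continuous_on_mult continuous_on_prod cvz)
    have "AE z in ?\<Lambda>. P \<theta>' ah z = P \<theta> ah (\<lambda>i\<in>{1..T}. v (z i)) * (\<Prod>i\<in>{1..T}. ennreal \<bar>det (matrix (blinfun_apply (v' (z i))))\<bar>)"
      by (rule density_eq_under_diffeomorphism[OF v'(1) \<open>bij v\<close> Jm inv_v _ Pm[OF model ah] Pm[OF model' ah]
          latent[OF ah, unfolded law]]) simp
    then show "AE z in ?\<Lambda>. (\<Prod>t\<in>{1..T}. path_density \<theta>' ah t z) =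
      (\<Prod>t\<in>{1..T}. path_density \<theta> ah t (\<lambda>i\<in>{1..T}. v (z i))) * (\<Prod>t\<in>{1..T}. J (z t))"
    proof eventually_elim
      case (elim z)
      have "0 \<le> (\<Prod>t\<in>{1..T}. path_density \<theta>' ah t z)" "0 \<le> (\<Prod>t\<in>{1..T}. path_density \<theta> ah t (\<lambda>i\<in>{1..T}. v (z i)))"
        using Ppos[OF model' ah] Ppos[OF model ah] by (simp_all add: less_imp_le)
      with elim show ?case
        unfolding P_def J_def[symmetric] by (simp add: prod_ennreal J0 prod_nonneg flip: ennreal_mult)
    qed
  qed simp
  \<comment> \<open>Stated for arbitrary functions of time instead of extensional paths, so that
    coordinate \<open>Suc n\<close> can be updated freely in the descent.\<close>
  have all: "(\<Prod>t\<in>{1..n}. path_density \<theta>' ah t z) =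
      (\<Prod>t\<in>{1..n}. path_density \<theta> ah t (\<lambda>i. v (z i))) * (\<Prod>t\<in>{1..n}. J (z t))"
    if "n \<le> T" and ah: "ah \<in> a_hists \<A> T" for ah z n
    using that(1)
  proof (induction n arbitrary: z rule: inc_induct)
    case base
    have "(\<Prod>t\<in>{1..T}. path_density \<theta>' ah t z) = (\<Prod>t\<in>{1..T}. path_density \<theta>' ah t (restrict z {1..T}))"
      by (intro prod.cong path_density_cong) auto
    also have "\<dots> = (\<Prod>t\<in>{1..T}. path_density \<theta> ah t (\<lambda>i\<in>{1..T}. v (restrict z {1..T} i))) * (\<Prod>t\<in>{1..T}. J (restrict z {1..T} t))"
      by (rule top[OF ah]) simp
    also have "\<dots> = (\<Prod>t\<in>{1..T}. path_density \<theta> ah t (\<lambda>i. v (z i))) * (\<Prod>t\<in>{1..T}. J (z t))"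
      by (intro arg_cong2[where f = "(*)"] prod.cong path_density_cong) auto
    finally show ?case .
  next
    case (step n)
    then have n: "Suc n \<le> T" "n \<le> T" by simp_all
    let ?vz = "\<lambda>i. v (z i)"
    let ?h = "\<lambda>y. ennreal (\<Prod>t\<in>{1..Suc n}. path_density \<theta> ah t (?vz(Suc n := y)))"
    let ?c = "\<Prod>t\<in>{1..n}. J (z t)"
    have upd_cont: "continuous_on UNIV (\<lambda>y. (?vz(Suc n := y)) s)" for s
      by (cases "s = Suc n") auto
    have hm: "?h \<in> borel_measurable borel"
    proof (intro measurable_compose[OF _ measurable_ennreal] borel_measurable_prod borel_measurable_continuous_onI)
      fix t assume t: "t \<in> {1..Suc n}"
      then show "continuous_on UNIV (\<lambda>y. path_density \<theta> ah t (?vz(Suc n := y)))"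
        using n ah upd_cont by (intro path_density_continuous[OF C2]) auto
    qed
    have upd: "(\<lambda>i. v ((z(Suc n := y)) i)) = ?vz(Suc n := v y)" for y by auto
    have Jc: "(\<Prod>t\<in>{1..Suc n}. J ((z(Suc n := y)) t)) = J y * ?c" for y
    proof -
      have "(\<Prod>t\<in>{1..n}. J ((z(Suc n := y)) t)) = ?c" by (rule prod.cong) auto
      then show ?thesis by simp
    qed
    have c0: "0 \<le> ?c" using J0 by (intro prod_nonneg) auto
    have p0: "0 \<le> (\<Prod>t\<in>{1..Suc n}. path_density \<theta> ah t z')" for z'
      using Ppos[OF model ah n(1)] by (rule less_imp_le)
    have em: "ennreal (a * (b * c)) = ennreal a * ennreal b * ennreal c" if "0 \<le> a" "0 \<le> b" "0 \<le> c" for a b c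
      using that by (simp add: ennreal_mult mult.assoc)
    have "ennreal (\<Prod>t\<in>{1..n}. path_density \<theta>' ah t z) =
        (\<integral>\<^sup>+y. ennreal (\<Prod>t\<in>{1..Suc n}. path_density \<theta>' ah t (z(Suc n := y))) \<partial>lborel)"
      by (rule nn_integral_path_density_last[OF model' ah n(1), symmetric])
    also have "\<dots> = (\<integral>\<^sup>+y. ?h (v y) * ennreal (J y) * ennreal ?c \<partial>lborel)"
      unfolding step.IH upd Jc by (simp only: em[OF p0 J0 c0])
    also have "\<dots> = (\<integral>\<^sup>+y. ?h (v y) * ennreal (J y) \<partial>lborel) * ennreal ?c"
    proof (rule nn_integral_multc)
      have "J \<in> borel_measurable borel" by (rule borel_measurable_continuous_onI[OF cJ])
      moreover have "(\<lambda>y. ?h (v y)) \<in> borel_measurable borel" by (rule measurable_compose[OF _ hm]) simp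
      ultimately show "(\<lambda>y. ?h (v y) * ennreal (J y)) \<in> borel_measurable lborel"
        by (simp add: borel_measurable_times_ennreal)
    qed
    \<comment> \<open>The Jacobian of the last coordinate is used up by substituting
      \<open>v y\<close> for \<open>y\<close>; the remaining integral drops the last factor of
      \<open>\<theta>\<close> just as the left-hand side drops that of
      \<open>\<theta>'\<close>.\<close>
    also have "(\<integral>\<^sup>+y. ?h (v y) * ennreal (J y) \<partial>lborel) = (\<integral>\<^sup>+y. ?h y \<partial>lborel)"
      unfolding J_def by (rule nn_integral_change_of_variables[OF v'(1) \<open>bij v\<close> Jm hm, symmetric])
    also have "\<dots> = ennreal (\<Prod>t\<in>{1..n}. path_density \<theta> ah t ?vz)"
      by (rule nn_integral_path_density_last[OF model ah n(1)])
    finally have "ennreal (\<Prod>t\<in>{1..n}. path_density \<theta>' ah t z) =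
        ennreal ((\<Prod>t\<in>{1..n}. path_density \<theta> ah t ?vz) * ?c)"
      using c0 by (simp add: ennreal_mult'')
    moreover have "0 < (\<Prod>t\<in>{1..n}. path_density \<theta>' ah t z)" "0 < (\<Prod>t\<in>{1..n}. path_density \<theta> ah t ?vz)"
      using Ppos[OF model' ah n(2)] Ppos[OF model ah n(2)] by blast+
    ultimately show ?case
      using c0 by (subst (asm) ennreal_inj) (simp_all add: less_imp_le)
  qed
  have single: "path_density \<theta>' ah t z = path_density \<theta> ah t (\<lambda>i. v (z i)) * J (z t)"
    if ah: "ah \<in> a_hists \<A> T" and t: "t \<in> {1..T}" for ah t z
  proof -
    \<comment> \<open>The identities of lengths \<open>n\<close> and \<open>Suc n\<close> are
      divided. For \<open>n = 0\<close> the products are empty, which covers the first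
      transition.\<close>
    obtain n where n: "t = Suc n" "Suc n \<le> T" using t by (cases t) auto
    have pos: "0 < (\<Prod>t\<in>{1..n}. path_density \<theta>' ah t z)"
      using n by (intro Ppos[OF model' ah]) simp
    have cancel: "a = b * c" if "A * a = (B * b) * (C * c)" "A = B * C" "0 < A" for a b c A B C :: real
    proof -
      have "A * a = A * (b * c)" unfolding that(1) by (simp only: that(2) mult_ac)
      then show ?thesis using that(3) by simp
    qed
    have split: "(\<Prod>t\<in>{1..Suc n}. f t) = (\<Prod>t\<in>{1..n}. f t) * f (Suc n)" for f :: "nat \<Rightarrow> real"
      by simp
    show ?thesis
      unfolding n(1)
      by (rule cancel[OF all[OF n(2) ah, of z, unfolded split] all[OF Suc_leD[OF n(2)] ah, of z] pos])
  qed
  have "trans_density \<theta>' t z zh ah = trans_density \<theta> t (v z) (\<lambda>s\<in>{1..<t}. v (zh s)) ah * \<bar>det (jacobian v (at z))\<bar>"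
    if t: "t \<in> {1..T}" and ah: "ah \<in> a_hists \<A> t" and zh: "zh \<in> z_hists t" for t ah zh z
  proof -
    \<comment> \<open>The identity needs a history of length \<open>T\<close>, but the transition at
      \<open>t\<close> sees only its first \<open>t\<close> columns, where \<open>b\<close> agrees
      with \<open>ah\<close>.\<close>
    define b where "b = (\<lambda>s\<in>{0..<T}. if s < t then ah s else a0)"
    have b: "b \<in> a_hists \<A> T" using ah a0 by (auto simp: b_def PiE_iff)
    have rb: "restrict b {0..<t} = ah"
      using ah t by (auto simp: b_def fun_eq_iff PiE_iff extensional_def)
    have rz: "restrict (zh(t := z)) {1..<t} = zh"
      using zh by (auto simp: fun_eq_iff PiE_iff extensional_def)
    have rv: "restrict (\<lambda>i. v ((zh(t := z)) i)) {1..<t} = (\<lambda>s\<in>{1..<t}. v (zh s))"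
      by (auto simp: fun_eq_iff)
    have jac: "jacobian v (at z) = matrix (blinfun_apply (v' z))"
      by (simp add: jacobian_def frechet_derivative_at[OF v'(1), symmetric])
    show ?thesis
      using single[OF b t, of "zh(t := z)"]
      by (simp only: path_density_def rb rz rv J_def jac fun_upd_same)
  qed
  then show ?thesis
    using range dv unfolding diff_equivalent_def Let_def v_def m_def m'_def by auto
qed

subsection \<open>Score differences and the sparsity of the entanglement map\<close>

text \<open>The current value is the coordinate \<open>None\<close> of the flattened family, so the
  derivative wanted is the partial derivative in that coordinate.\<close>

lemma factor_differentiable:
  assumes C2: "C2_factors T \<A> \<theta>" and t: "t \<in> {1..T}" and ah: "ah \<in> a_hists \<A> t" and zh: "zh \<in> z_hists t"
  shows "(\<lambda>s. factor \<theta> t i s zh ah) differentiable at s"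
proof -
  let ?I = "insert None (Some ` ({1..<t} \<times> UNIV))"
  let ?g = "\<lambda>y. factor \<theta> t i (y None) (\<lambda>r\<in>{1..<t}. \<chi> j. y (Some (r, j))) ah"
  have "Ck_coord (Suc (Suc 0)) ?I ?g"
    using C2 t ah unfolding C2_factors_def numeral_2_eq_2 by blast
  then have "\<forall>k\<in>?I. \<exists>g'. (\<forall>x\<in>?I \<rightarrow>\<^sub>E UNIV. ((\<lambda>u. ?g (x(k := u))) has_real_derivative g' x) (at (x k))) \<and>
      Ck_coord (Suc 0) ?I g'"
    unfolding Ck_coord.simps(2)[of "Suc 0"] by (rule conjunct2)
  from bspec[OF this insertI1] obtain g' where
    "\<forall>x\<in>?I \<rightarrow>\<^sub>E UNIV. ((\<lambda>u. ?g (x(None := u))) has_real_derivative g' x) (at (x None))"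
    by (elim exE conjE) (rule that)
  note g' = bspec[OF this]
  define y where "y k = (case k of None \<Rightarrow> s | Some (r, j) \<Rightarrow> if r \<in> {1..<t} then zh r $ j else undefined)" for k
  have y: "y \<in> ?I \<rightarrow>\<^sub>E UNIV"
    by (auto simp: y_def PiE_iff extensional_def split: option.splits)
  have z: "(\<lambda>r\<in>{1..<t}. \<chi> j. y (Some (r, j))) = zh"
    using zh by (auto simp: y_def fun_eq_iff vec_eq_iff PiE_iff extensional_def)
  have "y None = s" by (simp add: y_def)
  moreover have "(\<lambda>u. ?g (y(None := u))) = (\<lambda>u. factor \<theta> t i u zh ah)"
    by (simp add: z[unfolded One_nat_def])
  ultimately show ?thesis
    using g'[OF y] unfolding real_differentiable_def by auto
qed

context
  fixes T :: nat and \<A> :: "(real^'a) set" and \<theta> :: "('x::finite, 'z::finite, 'a::finite) latent_model"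
    and t :: nat and zh :: "nat \<Rightarrow> real^'z" and ah :: "nat \<Rightarrow> real^'a"
  assumes model: "graphical_latent_model T \<A> \<theta>" and C2: "C2_factors T \<A> \<theta>"
    and t: "t \<in> {1..T}" and ah: "ah \<in> a_hists \<A> t" and zh: "zh \<in> z_hists t"
begin

lemma log_factor_derivative:
  "((\<lambda>s. ln (factor \<theta> t i s zh ah)) has_real_derivative deriv (\<lambda>s. ln (factor \<theta> t i s zh ah)) s) (at s)"
proof -
  obtain d where "((\<lambda>s. factor \<theta> t i s zh ah) has_real_derivative d) (at s)"
    using factor_differentiable[OF C2 t ah zh] by (auto simp: real_differentiable_def)
  from DERIV_chain2[OF DERIV_ln[OF factor_pos[OF model t ah zh]] this] show ?thesis
    unfolding DERIV_deriv_iff_real_differentiable real_differentiable_def by (rule exI)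
qed

lemma ln_trans_density: "ln (trans_density \<theta> t z zh ah) = (\<Sum>i\<in>UNIV. ln (factor \<theta> t i (z $ i) zh ah))"
  unfolding trans_density_def by (rule ln_prod) (simp_all add: factor_pos[OF model t ah zh] less_imp_neq[THEN not_sym])

text \<open>The log density is a sum of functions of single coordinates, so varying coordinate
  \<open>i\<close> touches only the summand of \<open>i\<close>.\<close>

lemma score_component: "score \<theta> t z zh ah $ i = deriv (\<lambda>s. ln (factor \<theta> t i s zh ah)) (z $ i)"
proof -
  let ?d = "\<lambda>k. deriv (\<lambda>s. ln (factor \<theta> t k s zh ah)) (z $ k)"
  have "((\<lambda>u. \<Sum>k\<in>UNIV. ln (factor \<theta> t k (if k = i then u else z $ k) zh ah)) has_real_derivative
     (\<Sum>k\<in>UNIV. if k = i then ?d k else 0)) (at (z $ i))"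
  proof (rule DERIV_sum)
    fix k
    show "((\<lambda>u. ln (factor \<theta> t k (if k = i then u else z $ k) zh ah)) has_real_derivative
       (if k = i then ?d k else 0)) (at (z $ i))"
      using log_factor_derivative[of i "z $ i"] by (cases "k = i") auto
  qed
  then show ?thesis
    unfolding score_def ln_trans_density by (simp add: DERIV_imp_deriv)
qed

text \<open>The chain rule along \<open>v\<close> requires a total derivative, whereas
  \<open>score\<close> collects partial ones; the additive form of the log density bridges the
  two.\<close>

lemma log_trans_density_derivative:
  "((\<lambda>z. ln (trans_density \<theta> t z zh ah)) has_derivative (\<lambda>h. score \<theta> t z zh ah \<bullet> h)) (at z)"
proof -
  have "((\<lambda>z. \<Sum>i\<in>UNIV. ln (factor \<theta> t i (z $ i) zh ah)) has_derivative
     (\<lambda>h. \<Sum>i\<in>UNIV. deriv (\<lambda>s. ln (factor \<theta> t i s zh ah)) (z $ i) * h $ i)) (at z)"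
  proof (rule has_derivative_sum)
    fix i
    have "((\<lambda>z::real^'z. z $ i) has_derivative (\<lambda>h. h $ i)) (at z)"
      by (rule bounded_linear_imp_has_derivative[OF bounded_linear_vec_nth])
    from has_derivative_compose[OF this log_factor_derivative[unfolded has_field_derivative_def]]
    show "((\<lambda>z. ln (factor \<theta> t i (z $ i) zh ah)) has_derivative
       (\<lambda>h. deriv (\<lambda>s. ln (factor \<theta> t i s zh ah)) (z $ i) * h $ i)) (at z)" .
  qed
  then show ?thesis
    unfolding ln_trans_density by (simp add: inner_vec_def score_component)
qed

end

text \<open>Changing row \<open>l\<close> of the history leaves the factor of a non-child untouched,
  and the score entry \<open>i\<close> involves no other factor.\<close>

lemma score_difference_eq_0_if_not_child:
  assumes model: "graphical_latent_model T \<A> \<theta>" and C2: "C2_factors T \<A> \<theta>"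
    and t: "t \<in> {1..T}" and ah: "ah \<in> a_hists \<A> t" and zh: "zh \<in> z_hists t"
    and ah': "ah(\<tau> := ah \<tau> + \<epsilon> *\<^sub>R axis l 1) \<in> a_hists \<A> t" and i: "i \<notin> children_a \<theta> l"
  shows "score_difference \<theta> l \<tau> \<epsilon> t z zh ah $ i = 0"
proof -
  let ?ah = "ah(\<tau> := ah \<tau> + \<epsilon> *\<^sub>R axis l 1)"
  have "?ah s $ k = ah s $ k" if "graph_a \<theta> $ i $ k = 1" for s k
    using that i by (auto simp: children_a_def axis_def)
  then have "factor \<theta> t i s zh ?ah = factor \<theta> t i s zh ah" for s
    using model t zh ah ah' unfolding graphical_latent_model_def by blast
  then show ?thesis
    by (simp add: score_difference_def score_component[OF model C2 t ah zh] score_component[OF model C2 t ah' zh])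
qed

text \<open>
  The Jacobian factor in the change of densities does not depend on \<open>a\<close>, so it cancels in
  the partial difference, before any derivative of \<open>Dv\<close> could be needed.
\<close>

lemma score_difference_transform:
  fixes \<theta> \<theta>' :: "('x::finite, 'z::finite, 'a::finite) latent_model"
  assumes model: "graphical_latent_model T \<A> \<theta>" and model': "graphical_latent_model T \<A> \<theta>'"
    and C2: "C2_factors T \<A> \<theta>" and C2': "C2_factors T \<A> \<theta>'"
    and diff: "diff_equivalent T \<A> \<theta> \<theta>'" and v: "v = entanglement_map \<theta> \<theta>'"
    and v': "(v has_derivative v') (at z)"
    and t: "t \<in> {1..T}" and ah: "ah \<in> a_hists \<A> t" and zh: "zh \<in> z_hists t"
    and ah': "ah(\<tau> := ah \<tau> + \<epsilon> *\<^sub>R axis l 1) \<in> a_hists \<A> t"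
  shows "score_difference \<theta>' l \<tau> \<epsilon> t z zh ah \<bullet> h =
    score_difference \<theta> l \<tau> \<epsilon> t (v z) (\<lambda>s\<in>{1..<t}. v (zh s)) ah \<bullet> v' h"
proof -
  let ?ah = "ah(\<tau> := ah \<tau> + \<epsilon> *\<^sub>R axis l 1)" and ?vh = "\<lambda>s\<in>{1..<t}. v (zh s)"
  have vh: "?vh \<in> z_hists t" by simp
  have tr: "trans_density \<theta>' t z zh b = trans_density \<theta> t (v z) ?vh b * \<bar>det (jacobian v (at z))\<bar>"
    if "b \<in> a_hists \<A> t" for b z
    using diff that t zh unfolding diff_equivalent_def Let_def v by blast
  have eq: "ln (trans_density \<theta>' t z zh ?ah) - ln (trans_density \<theta>' t z zh ah) =
     ln (trans_density \<theta> t (v z) ?vh ?ah) - ln (trans_density \<theta> t (v z) ?vh ah)" for z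
  proof -
    note pos = trans_density_pos[OF model t ah vh, of "v z"] trans_density_pos[OF model t ah' vh, of "v z"]
    \<comment> \<open>Positivity of the density of \<open>\<theta>'\<close> excludes a zero Jacobian
      determinant, so the logarithm of the product splits and the Jacobian term cancels.\<close>
    have "0 < trans_density \<theta>' t z zh ah" by (rule trans_density_pos[OF model' t ah zh])
    then have "\<bar>det (jacobian v (at z))\<bar> > 0"
      using tr[OF ah] by (cases "det (jacobian v (at z)) = 0") auto
    then show ?thesis
      using pos by (simp add: tr[OF ah] tr[OF ah'] ln_mult_pos)
  qed
  have "((\<lambda>z. ln (trans_density \<theta>' t z zh ?ah) - ln (trans_density \<theta>' t z zh ah)) has_derivative
     (\<lambda>h. score \<theta>' t z zh ?ah \<bullet> h - score \<theta>' t z zh ah \<bullet> h)) (at z)"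
    by (intro has_derivative_diff log_trans_density_derivative[OF model' C2' t ah' zh]
        log_trans_density_derivative[OF model' C2' t ah zh])
  moreover have "((\<lambda>z. ln (trans_density \<theta> t (v z) ?vh ?ah) - ln (trans_density \<theta> t (v z) ?vh ah)) has_derivative
     (\<lambda>h. score \<theta> t (v z) ?vh ?ah \<bullet> v' h - score \<theta> t (v z) ?vh ah \<bullet> v' h)) (at z)"
    by (intro has_derivative_diff has_derivative_compose[OF v' log_trans_density_derivative[OF model C2 t ah' vh]]
        has_derivative_compose[OF v' log_trans_density_derivative[OF model C2 t ah vh]])
  ultimately have "(\<lambda>h. score \<theta>' t z zh ?ah \<bullet> h - score \<theta>' t z zh ah \<bullet> h) =
     (\<lambda>h. score \<theta> t (v z) ?vh ?ah \<bullet> v' h - score \<theta> t (v z) ?vh ah \<bullet> v' h)"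
    unfolding eq by (rule has_derivative_unique)
  from fun_cong[OF this, of h] show ?thesis
    by (simp add: score_difference_def inner_diff_left)
qed

lemma AE_lborel_meets_open:
  fixes U :: "'b::euclidean_space set"
  assumes "AE x in lborel. P x" "open U" "U \<noteq> {}"
  obtains x where "x \<in> U" "P x"
proof -
  have "\<exists>x\<in>U. P x"
  proof (rule ccontr)
    assume "\<not> (\<exists>x\<in>U. P x)"
    with assms(1) have "AE x in lborel. x \<notin> U" by (auto elim!: eventually_mono)
    then have "U \<in> null_sets lborel" using assms(2) by (subst AE_iff_null_sets) auto
    then have "negligible U" by (simp add: negligible_iff_null_sets null_sets_completionI)
    then show False using open_not_negligible assms by blast
  qed
  then show thesis using that by blast
qed

text \<open>A nonzero entry would persist on an open set, which contains a point whose image under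
  \<open>v\<close> satisfies the span condition. There column \<open>j\<close> of \<open>Dv\<close>
  is orthogonal to all chosen score differences of \<open>\<theta>\<close>, because entry
  \<open>j\<close> of those of \<open>\<theta>'\<close> vanishes; hence it is orthogonal to the
  basis vector at \<open>i\<close>.\<close>

lemma entanglement_derivative_eq_0:
  fixes \<theta> \<theta>' :: "('x::finite, 'z::finite, 'a::finite) latent_model"
  assumes model: "graphical_latent_model T \<A> \<theta>" and model': "graphical_latent_model T \<A> \<theta>'"
    and C2: "C2_factors T \<A> \<theta>" and C2': "C2_factors T \<A> \<theta>'"
    and influence: "sufficient_influence_a T \<A> \<theta>"
    and diff: "diff_equivalent T \<A> \<theta> \<theta>'" and v: "v = entanglement_map \<theta> \<theta>'"
    and diffeo: "diffeomorphism_on UNIV UNIV v"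
    and v': "\<And>z. (v has_derivative blinfun_apply (v' z)) (at z)" and cont: "continuous_on UNIV v'"
    and i: "i \<in> children_a \<theta> l" and j: "j \<notin> children_a \<theta>' l"
  shows "v' z (axis j 1) $ i = 0"
proof (rule ccontr)
  assume ne: "v' z (axis j 1) $ i \<noteq> 0"
  define U where "U = {z. v' z (axis j 1) $ i \<noteq> 0}"
  have "continuous_on UNIV (\<lambda>z. v' z (axis j 1) $ i)"
    by (intro continuous_intros cont)
  then have U: "open U"
    unfolding U_def by (intro open_Collect_neq) (auto intro: continuous_intros)
  have bij: "bij v" and cinv: "continuous_on UNIV (inv v)"
    using diffeo by (auto simp: diffeomorphism_on_def intro: C1_on_continuous_on)
  \<comment> \<open>The span condition concerns points \<open>w = v x\<close>, so \<open>U\<close>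
    is moved to its image under \<open>v\<close>, written as a preimage under
    \<open>inv v\<close>.\<close>
  have "open (inv v -` U)" using open_vimage[OF U cinv] .
  moreover have "v z \<in> inv v -` U" using ne bij by (simp add: U_def bij_is_inj)
  then have "inv v -` U \<noteq> {}" by blast
  ultimately obtain w where w: "w \<in> inv v -` U" and inf: "\<forall>l. \<exists>t \<tau> zh ah \<epsilon>.
        (\<forall>r\<in>{1..card (children_a \<theta> l)}.
           t r \<in> {1..T} \<and> \<tau> r < t r \<and> zh r \<in> z_hists (t r) \<and> ah r \<in> a_hists \<A> (t r) \<and>
           ah r (\<tau> r) + \<epsilon> r *\<^sub>R axis l 1 \<in> \<A>) \<and>
        span ((\<lambda>r. score_difference \<theta> l (\<tau> r) (\<epsilon> r) (t r) w (zh r) (ah r)) `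
              {1..card (children_a \<theta> l)}) = coord_subspace (children_a \<theta> l)"
    by (rule AE_lborel_meets_open[OF influence[unfolded sufficient_influence_a_def]])
  define x where "x = inv v w"
  have vx: "v x = w" using bij by (simp add: x_def bij_is_surj surj_f_inv_f)
  from spec[OF inf, of l] obtain t \<tau> zh ah \<epsilon> where a: "\<forall>r\<in>{1..card (children_a \<theta> l)}.
           t r \<in> {1..T} \<and> \<tau> r < t r \<and> zh r \<in> z_hists (t r) \<and> ah r \<in> a_hists \<A> (t r) \<and>
           ah r (\<tau> r) + \<epsilon> r *\<^sub>R axis l 1 \<in> \<A>"
    and span: "span ((\<lambda>r. score_difference \<theta> l (\<tau> r) (\<epsilon> r) (t r) w (zh r) (ah r)) `
              {1..card (children_a \<theta> l)}) = coord_subspace (children_a \<theta> l)"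
    by (elim exE conjE) (rule that)
  note tup = bspec[OF a]
  let ?u = "v' x (axis j 1)"
  have key: "score_difference \<theta> l (\<tau> r) (\<epsilon> r) (t r) w (zh r) (ah r) \<bullet> ?u = 0"
    if r: "r \<in> {1..card (children_a \<theta> l)}" for r
  proof -
    note p = tup[OF r]
    \<comment> \<open>The histories of the span condition belong to \<open>\<theta>\<close>;
      \<open>\<theta>'\<close> is evaluated at their preimages under \<open>v\<close>, which
      \<open>v\<close> maps back to \<open>zh r\<close>.\<close>
    let ?zh = "\<lambda>s\<in>{1..<t r}. inv v (zh r s)"
    have ah1: "(ah r)(\<tau> r := ah r (\<tau> r) + \<epsilon> r *\<^sub>R axis l 1) \<in> a_hists \<A> (t r)"
      using p by (auto simp: PiE_iff extensional_def)
    have vz: "(\<lambda>s\<in>{1..<t r}. v (?zh s)) = zh r"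
      using p bij by (auto simp: fun_eq_iff PiE_iff extensional_def bij_is_surj surj_f_inv_f)
    have "score_difference \<theta> l (\<tau> r) (\<epsilon> r) (t r) w (zh r) (ah r) \<bullet> ?u =
        score_difference \<theta>' l (\<tau> r) (\<epsilon> r) (t r) x ?zh (ah r) \<bullet> axis j 1"
      using score_difference_transform[OF model model' C2 C2' diff v v', of "t r" "ah r" ?zh "\<tau> r" "\<epsilon> r" l x "axis j 1"]
        p ah1 by (simp only: vx vz) simp
    also have "\<dots> = score_difference \<theta>' l (\<tau> r) (\<epsilon> r) (t r) x ?zh (ah r) $ j"
      by (simp add: inner_axis)
    also have "\<dots> = 0"
      by (rule score_difference_eq_0_if_not_child[OF model' C2' _ _ _ ah1 j]) (use p in auto)
    finally show ?thesis .
  qed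
  have "?u \<bullet> y = 0" if "y \<in> span ((\<lambda>r. score_difference \<theta> l (\<tau> r) (\<epsilon> r) (t r) w (zh r) (ah r)) `
              {1..card (children_a \<theta> l)})" for y
  proof -
    have "orthogonal ?u y"
      by (rule orthogonal_to_span[OF that]) (use key in \<open>auto simp: orthogonal_def inner_commute[of ?u]\<close>)
    then show ?thesis by (simp add: orthogonal_def)
  qed
  moreover have "axis i 1 \<in> coord_subspace (children_a \<theta> l)"
    using i by (auto simp: coord_subspace_def axis_def)
  ultimately have "?u $ i = 0" unfolding span by (metis inner_axis inner_real_def mult.right_neutral)
  then show False using w by (simp add: U_def x_def)
qed

subsection \<open>Permutations and dependency graphs\<close>

lemma C1_on_bounded_linear:
  assumes "bounded_linear f"
  shows "C1_on UNIV f"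
  unfolding C1_on_def
  by (intro exI[of _ UNIV] exI[of _ f] conjI exI[of _ "\<lambda>_. Blinfun f"])
    (auto simp: bounded_linear_Blinfun_apply assms intro: bounded_linear_imp_has_derivative)

definition perm_matrix :: "('n \<Rightarrow> 'n) \<Rightarrow> real^'n^'n" where
  "perm_matrix \<pi> = (\<chi> i j. if i = \<pi> j then 1 else 0)"

lemma permutation_matrix_perm_matrix: "bij \<pi> \<Longrightarrow> permutation_matrix (perm_matrix \<pi>)"
  unfolding permutation_matrix_def perm_matrix_def by blast

lemma perm_matrix_mult:
  assumes "bij \<pi>"
  shows "(perm_matrix \<pi> ** (G :: real^'m^'n)) $ \<pi> i $ l = G $ i $ l"
  using assms by (simp add: perm_matrix_def matrix_matrix_mult_def inj_eq[OF bij_is_inj] if_distrib[of "\<lambda>x. x * _"] cong: if_cong)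

lemma perm_matrix_vector:
  assumes "bij \<pi>"
  shows "(perm_matrix \<pi> *v x) $ \<pi> i = x $ i" "(transpose (perm_matrix \<pi>) *v x) $ i = x $ \<pi> i"
  using assms by (simp_all add: perm_matrix_def matrix_vector_mult_def transpose_def inj_eq[OF bij_is_inj]
      if_distrib[of "\<lambda>x. x * _"] cong: if_cong)

lemma perm_matrix_inverse:
  assumes "bij \<pi>"
  shows "perm_matrix \<pi> *v (transpose (perm_matrix \<pi>) *v x) = x"
    and "transpose (perm_matrix \<pi>) *v (perm_matrix \<pi> *v x) = x"
proof -
  have "(perm_matrix \<pi> *v (transpose (perm_matrix \<pi>) *v x)) $ i = x $ i" for i
  proof -
    obtain k where "i = \<pi> k" using assms by (metis bij_pointE)
    then show ?thesis by (simp only: perm_matrix_vector[OF assms])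
  qed
  then show "perm_matrix \<pi> *v (transpose (perm_matrix \<pi>) *v x) = x" by (simp add: vec_eq_iff)
  show "transpose (perm_matrix \<pi>) *v (perm_matrix \<pi> *v x) = x"
    by (simp add: vec_eq_iff perm_matrix_vector[OF assms] del: transpose_matrix_vector)
qed

lemma perm_matrix_mult_nz:
  assumes "bij \<pi>"
  shows "{(i, l). (perm_matrix \<pi> ** (G :: real^'m^'n)) $ i $ l \<noteq> 0} = map_prod \<pi> id ` {(i, l). G $ i $ l \<noteq> 0}"
proof (intro set_eqI iffI)
  fix x assume "x \<in> {(i, l). (perm_matrix \<pi> ** G) $ i $ l \<noteq> 0}"
  then obtain i l where x: "x = (i, l)" "(perm_matrix \<pi> ** G) $ i $ l \<noteq> 0" by auto
  obtain k where "i = \<pi> k" using assms by (metis bij_pointE)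
  with x show "x \<in> map_prod \<pi> id ` {(i, l). G $ i $ l \<noteq> 0}"
    by (auto simp: perm_matrix_mult[OF assms] intro!: image_eqI[of _ _ "(k, l)"])
qed (auto simp: perm_matrix_mult[OF assms])

lemma l0_norm_perm_matrix_mult:
  assumes "bij \<pi>"
  shows "l0_norm (perm_matrix \<pi> ** (G :: real^'m^'n)) = l0_norm G"
  unfolding l0_norm_def perm_matrix_mult_nz[OF assms]
  using assms by (intro card_image inj_on_subset[OF prod.inj_map] ) (auto simp: bij_is_inj)

text \<open>A finite support contained in one that is not larger equals it, and a binary matrix is
  determined by its support.\<close>

lemma binary_matrix_eqI_of_l0_norm_le:
  fixes A B :: "real^'m^'n"
  assumes "binary_matrix A" "binary_matrix B" "pattern_subset A B" "l0_norm B \<le> l0_norm A"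
  shows "A = B"
proof -
  have "{(i, j). A $ i $ j \<noteq> 0} = {(i, j). B $ i $ j \<noteq> 0}"
    using assms(3,4) unfolding pattern_subset_def l0_norm_def
    by (intro card_seteq) auto
  then have nz: "A $ i $ j \<noteq> 0 \<longleftrightarrow> B $ i $ j \<noteq> 0" for i j by blast
  have "A $ i $ j = B $ i $ j" for i j
    using nz[of i j] assms(1,2) unfolding binary_matrix_def by (metis insertE singletonD)
  then show ?thesis by (simp add: vec_eq_iff)
qed

lemma det_nonzero_permutation:
  fixes A :: "real^'n^'n"
  assumes "det A \<noteq> 0"
  obtains p where "bij p" "\<And>i. A $ i $ p i \<noteq> 0"
proof -
  obtain p where "p permutes (UNIV::'n set)" "of_int (sign p) * (\<Prod>i\<in>UNIV. A $ i $ p i) \<noteq> 0"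
    using assms unfolding det_def by (metis (mono_tags, lifting) mem_Collect_eq sum.neutral)
  then show thesis by (intro that[of p] permutes_bij[of p UNIV]) auto
qed

text \<open>A zero derivative along every line in direction \<open>j\<close> makes \<open>c\<close>
  constant on these lines; the witness \<open>hbar\<close> evaluates \<open>c\<close> where the line
  meets coordinate value 0.\<close>

lemma dependency_graph_eq_0:
  fixes c :: "real^'n \<Rightarrow> real^'m"
  assumes D: "\<And>x s. ((\<lambda>s. c (x + s *\<^sub>R axis j 1) $ i) has_real_derivative 0) (at s)"
  shows "dependency_graph c $ i $ j = 0"
proof -
  define hbar where "hbar g = c (\<chi> k. if k = j then 0 else g k) $ i" for g
  have "c x $ i = hbar (restrict (($) x) (- {j}))" for x
  proof -
    have "(\<lambda>s. c (x + s *\<^sub>R axis j 1) $ i) (- x $ j) = (\<lambda>s. c (x + s *\<^sub>R axis j 1) $ i) 0"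
      by (rule DERIV_isconst_all) (use D in blast)
    moreover have "x + (- x $ j) *\<^sub>R axis j 1 = (\<chi> k. if k = j then 0 else restrict (($) x) (- {j}) k)"
      by (auto simp: vec_eq_iff axis_def)
    ultimately show ?thesis by (simp add: hbar_def)
  qed
  then show ?thesis by (auto simp: dependency_graph_def)
qed

text \<open>Sparsity turns the inclusion of graphs into an equality. The zero pattern of
  \<open>Dv\<close> can then be expressed by the graph of \<open>\<theta>\<close> alone, which gives
  preservation for \<open>c\<close>.\<close>

theorem theorem2:
  fixes T :: nat and \<sigma>2 :: real and \<A> :: "(real^'a) set"
    and \<theta> \<theta>' :: "('x::finite, 'z::finite, 'a::finite) latent_model"
  assumes "1 \<le> T" and "CARD('z) \<le> CARD('x)" and "0 \<le> \<sigma>2" and "\<A> \<noteq> {}"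
    and "topological_space_class.discrete \<A>"
    and "graphical_latent_model T \<A> \<theta>" and "graphical_latent_model T \<A> \<theta>'"
    and "C2_factors T \<A> \<theta>" and "C2_factors T \<A> \<theta>'"
    and "obs_equivalent T \<A> \<sigma>2 \<theta> \<theta>'"
    and "sufficient_influence_a T \<A> \<theta>"
  shows "(\<exists>P::real^'z^'z. permutation_matrix P \<and> pattern_subset (P ** graph_a \<theta>) (graph_a \<theta>')) \<and>
         (l0_norm (graph_a \<theta>') \<le> l0_norm (graph_a \<theta>) \<longrightarrow> a_consistent T \<A> \<theta> \<theta>')"
proof -
  note model = assms(6) and model' = assms(7) and C2 = assms(8) and C2' = assms(9)
  define v where "v = entanglement_map \<theta> \<theta>'"
  have diff: "diff_equivalent T \<A> \<theta> \<theta>'" and dv: "diffeomorphism_on UNIV UNIV v"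
    using obs_equivalent_imp_diff_equivalent[OF assms(1,4,6-10)] by (simp_all add: v_def)
  obtain v' where v': "\<And>x. (v has_derivative blinfun_apply (v' x)) (at x)" "continuous_on UNIV v'"
    using dv C1_on_UNIV_E unfolding diffeomorphism_on_def by metis
  have bin: "binary_matrix (graph_a \<theta>)" "binary_matrix (graph_a \<theta>')"
    using model model' unfolding graphical_latent_model_def by blast+
  have ch: "i \<in> children_a \<phi> l \<longleftrightarrow> graph_a \<phi> $ i $ l \<noteq> 0" if "binary_matrix (graph_a \<phi>)"
    for \<phi> :: "('x, 'z, 'a) latent_model" and i l
    using that unfolding binary_matrix_def children_a_def by force
  have zero: "v' z (axis j 1) $ i = 0" if "graph_a \<theta> $ i $ l \<noteq> 0" "graph_a \<theta>' $ j $ l = 0" for z i j l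
    by (rule entanglement_derivative_eq_0[OF model model' C2 C2' assms(11) diff v_def dv v'])
       (use that bin ch in auto)
  \<comment> \<open>The density relation at time 1 yields invertibility: a vanishing determinant
    would annihilate a positive density.\<close>
  have det: "det (matrix (blinfun_apply (v' z))) \<noteq> 0" for z
  proof -
    obtain a0 where "a0 \<in> \<A>" using \<open>\<A> \<noteq> {}\<close> by blast
    then have ah: "(\<lambda>s\<in>{0..<1}. a0) \<in> a_hists \<A> 1" by auto
    have zh: "(\<lambda>s\<in>{1..<1}. 0) \<in> z_hists 1" by (rule restrict_PiE_iff[THEN iffD2]) simp
    have t: "1 \<in> {1..T}" using \<open>1 \<le> T\<close> by simp
    have "0 < trans_density \<theta>' 1 z (\<lambda>s\<in>{1..<1}. 0) (\<lambda>s\<in>{0..<1}. a0)"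
      by (rule trans_density_pos[OF model' t ah zh])
    moreover have "jacobian v (at z) = matrix (blinfun_apply (v' z))"
      by (simp add: jacobian_def frechet_derivative_at[OF v'(1), symmetric])
    moreover have "trans_density \<theta>' 1 z (\<lambda>s\<in>{1..<1}. 0) (\<lambda>s\<in>{0..<1}. a0) =
        trans_density \<theta> 1 (v z) (\<lambda>s\<in>{1..<1}. v ((\<lambda>s\<in>{1..<1}. 0) s)) (\<lambda>s\<in>{0..<1}. a0) * \<bar>det (jacobian v (at z))\<bar>"
      using diff t ah zh unfolding diff_equivalent_def Let_def v_def[symmetric] by blast
    ultimately show ?thesis by auto
  qed
  \<comment> \<open>The zeros in \<open>zero\<close> hold at every point, so the arbitrary base
    point 0 serves. Row \<open>i\<close> is matched with column \<open>p i\<close>.\<close>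
  obtain p where p: "bij p" and nz: "\<And>i. v' 0 (axis (p i) 1) $ i \<noteq> 0"
    using det_nonzero_permutation[OF det[of 0]] by (auto simp: matrix_def)
  let ?P = "perm_matrix p"
  have P: "permutation_matrix ?P" by (rule permutation_matrix_perm_matrix[OF p])
  have sub: "pattern_subset (?P ** graph_a \<theta>) (graph_a \<theta>')"
    unfolding pattern_subset_def
  proof (intro allI impI)
    fix i l assume ne: "(?P ** graph_a \<theta>) $ i $ l \<noteq> 0"
    obtain k where "i = p k" using p by (metis bij_pointE)
    \<comment> \<open>Contraposition of \<open>zero\<close>: entry \<open>(k, p k)\<close> of
      \<open>Dv(0)\<close> is nonzero, so every \<open>l\<close> having \<open>k\<close> as a child
      in \<open>\<theta>\<close> has \<open>p k\<close> as a child in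
      \<open>\<theta>'\<close>.\<close>
    with ne show "graph_a \<theta>' $ i $ l \<noteq> 0"
      using zero[of k l "p k" 0] nz[of k] by (auto simp: perm_matrix_mult[OF p])
  qed
  have "a_consistent T \<A> \<theta> \<theta>'" if le: "l0_norm (graph_a \<theta>') \<le> l0_norm (graph_a \<theta>)"
  proof -
    have "binary_matrix (?P ** graph_a \<theta>)"
      unfolding binary_matrix_def
    proof (intro allI)
      fix i l
      obtain k where "i = p k" using p by (metis bij_pointE)
      then show "(?P ** graph_a \<theta>) $ i $ l \<in> {0, 1}"
        using bin(1) by (simp add: perm_matrix_mult[OF p] binary_matrix_def)
    qed
    \<comment> \<open>Permuting rows keeps the number of nonzero entries, so under \<open>le\<close>
      the inclusion of supports cannot be proper.\<close>
    then have G': "?P ** graph_a \<theta> = graph_a \<theta>'"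
      by (rule binary_matrix_eqI_of_l0_norm_le[OF _ bin(2) sub]) (simp add: le l0_norm_perm_matrix_mult[OF p])
    \<comment> \<open>The only choice compatible with the required factorisation of
      \<open>v\<close>, as the transpose of \<open>?P\<close> is its inverse.\<close>
    define c where "c y = v (?P *v y)" for y
    have vc: "v = c \<circ> (\<lambda>z. transpose ?P *v z)"
      by (simp add: fun_eq_iff c_def perm_matrix_inverse[OF p] del: transpose_matrix_vector)
    have lin: "bounded_linear (\<lambda>y. ?P *v y)" "bounded_linear (\<lambda>z. transpose ?P *v z)"
      by (rule matrix_vector_mul_bounded_linear)+
    have bv: "bij v" and Cv: "C1_on UNIV v" "C1_on UNIV (inv v)"
      using dv by (auto simp: diffeomorphism_on_def)
    have c1: "C1_on UNIV c"
      using C1_on_comp[OF Cv(1) C1_on_bounded_linear[OF lin(1)]] by (simp add: c_def[abs_def] o_def)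
    have inv1: "transpose ?P *v inv v (c y) = y" for y
      using bv by (simp add: c_def bij_is_inj perm_matrix_inverse[OF p] del: transpose_matrix_vector)
    have inv2: "c (transpose ?P *v inv v x) = x" for x
      using bv by (simp add: c_def perm_matrix_inverse[OF p] bij_is_surj surj_f_inv_f del: transpose_matrix_vector)
    have bc: "bij c"
      by (rule bij_betw_byWitness[where f' = "\<lambda>x. transpose ?P *v inv v x"]) (use inv1 inv2 in auto)
    have "inv c = (\<lambda>x. transpose ?P *v inv v x)"
      by (rule inv_equality) (use inv1 inv2 in auto)
    then have "C1_on UNIV (inv c)"
      using C1_on_comp[OF C1_on_bounded_linear[OF lin(2)] Cv(2)] by (simp add: o_def del: transpose_matrix_vector)
    with c1 bc have dc: "diffeomorphism_on UNIV UNIV c"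
      by (simp add: diffeomorphism_on_def)
    \<comment> \<open>Column \<open>j\<close> of \<open>Dc\<close> is column \<open>p j\<close> of
      \<open>Dv\<close>, and by \<open>G'\<close> row \<open>p j\<close> of the graph of
      \<open>\<theta>'\<close> is row \<open>j\<close> of that of \<open>\<theta>\<close>; so
      \<open>zero\<close> becomes a statement about one graph.\<close>
    have dep: "graph_a \<theta> $ j $ l \<noteq> 0"
      if "dependency_graph c $ i $ j \<noteq> 0" "graph_a \<theta> $ i $ l \<noteq> 0" for i j l
    proof (rule ccontr)
      assume "\<not> graph_a \<theta> $ j $ l \<noteq> 0"
      then have "graph_a \<theta>' $ p j $ l = 0"
        unfolding G'[symmetric] by (simp add: perm_matrix_mult[OF p])
      then have z: "v' z (axis (p j) 1) $ i = 0" for z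
        using zero that(2) by blast
      have "?P *v axis j 1 = axis (p j) 1"
      proof -
        have "(?P *v axis j 1) $ k = (axis (p j) 1 :: real^'z) $ k" for k
        proof -
          obtain k' where "k = p k'" using p by (metis bij_pointE)
          then show ?thesis
            using p by (simp add: perm_matrix_vector[OF p] axis_def inj_eq[OF bij_is_inj])
        qed
        then show ?thesis by (simp add: vec_eq_iff)
      qed
      then have line: "c (x + s *\<^sub>R axis j 1) = v (?P *v x + s *\<^sub>R axis (p j) 1)" for x s
        by (simp add: c_def matrix_vector_right_distrib scaleR_matrix_vector_assoc[symmetric] matrix_vector_mult_scaleR)
      have "((\<lambda>s. c (x + s *\<^sub>R axis j 1) $ i) has_real_derivative 0) (at s)" for x s
      proof -
        have "((\<lambda>s. ?P *v x + s *\<^sub>R axis (p j) 1) has_derivative (\<lambda>h. h *\<^sub>R axis (p j) 1)) (at s)"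
          by (auto intro!: derivative_eq_intros)
        from has_derivative_compose[OF has_derivative_compose[OF this v'(1)]
            bounded_linear_imp_has_derivative[OF bounded_linear_vec_nth[of i]]]
        have "((\<lambda>s. c (x + s *\<^sub>R axis j 1) $ i) has_derivative
            (\<lambda>h. v' (?P *v x + s *\<^sub>R axis (p j) 1) (h *\<^sub>R axis (p j) 1) $ i)) (at s)"
          unfolding line .
        then show ?thesis
          by (simp add: has_field_derivative_def blinfun.scaleR_right z lambda_zero)
      qed
      from dependency_graph_eq_0[OF this] that(1) show False by blast
    qed
    have "preserving_function (graph_a \<theta>) c"
      unfolding preserving_function_def preserving_matrix_def matrix_subspace_def
    proof clarify
      fix M :: "real^'a^'z" and j l
      assume M: "\<forall>i l. graph_a \<theta> $ i $ l = 0 \<longrightarrow> M $ i $ l = 0" and "graph_a \<theta> $ j $ l = 0"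
      \<comment> \<open>Each summand of entry \<open>(j, l)\<close> vanishes: two nonzero factors
        would force \<open>graph_a \<theta> $ j $ l \<noteq> 0\<close> by
        \<open>dep\<close>.\<close>
      then have "dependency_graph c $ i $ j * M $ i $ l = 0" for i
        using dep[of i j l] by auto
      then show "(transpose (dependency_graph c) ** M) $ j $ l = 0"
        by (simp add: matrix_matrix_mult_def transpose_def sum.neutral)
    qed
    then show ?thesis
      unfolding a_consistent_def using P diff G' vc dc by (metis v_def)
  qed
  with P sub show ?thesis by blast
qed

end
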